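(* Let $c_0,c_1>0$ and let $\Delta_x=\Delta_t$. If $Y_0=X_0=-1$, then the interpolated persistent random walk $(\tilde Z^\Delta_s,\ s\ge 0)$ converges in distribution, as $\Delta_x\to 0$, to the process $(-Z^{c_0,c_1}_s,\ s\ge 0)$. In particular, if $c_0=c_1$, then $(N^{c_0,c_0}_u)_{u\ge 0}$ is the Poisson process with parameter (rate) $c_0$. If $Y_0=X_0=1$, then $(\tilde Z^\Delta_s,\ s\ge 0)$ converges in distribution, as $\Delta_x\to 0$, to the process $(Z^{c_1,c_0}_s,\ s\ge 0)$.
   Context: For small $\Delta_x>0$, $(Y_t)_{t\in\mathbb N}$ is the $\{-1,1\}$-valued Markov chain with transition matrix (rows and columns ordered as $-1,1$) $$\pi^\Delta=\begin{pmatrix}1-c_0\Delta_x & c_0\Delta_x\\ c_1\Delta_x & 1-c_1\Delta_x\end{pmatrix}.$$ The persistent random walk is $X_t=\sum_{i=0}^tY_i$ (so $X_0=Y_0$). The normalized walk is $Z^\Delta_s=\Delta_x X_{s/\Delta_t}$ for $s\in\Delta_t\mathbb N$, and $(\tilde Z^\Delta_s)_{s\ge0}$ is the continuous-time process obtained from $(Z^\Delta_s)_{s\in\Delta_t\mathbb N}$ by linear interpolation. Convergence in distribution of processes means weak convergence of laws on the space of continuous functions on $[0,\infty)$ with the topology of uniform convergence on compact sets. For $a,b>0$: let $(e_n)_{n\ge1}$ be i.i.d. exponential random variables with $\mathbb E[e_n]=1$, let $\lambda_k=1/a$ if $k$ is odd and $\lambda_k=1/b$ if $k$ is even, and set $$N^{a,b}_t=\sum_{k\ge1}1_{\{\lambda_1e_1+\dots+\lambda_ke_k\le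 t\}},\qquad Z^{a,b}_t=\int_0^t(-1)^{N^{a,b}_u}\,du,\qquad t\ge 0.$$ *)

theory Defs
  imports "HOL-Probability.Probability"
begin

text \<open>The space of continuous real functions on $[0,\infty)$. Its elements are represented by
  functions on \<^typ>\<open>real\<close> that are \<^const>\<open>undefined\<close> at negative arguments, so that equality
  of representatives is equality on $[0,\infty)$.\<close>

typedef cpath = "{f :: real \<Rightarrow> real. continuous_on {0..} f \<and> f \<in> extensional {0..}}"
  morphisms eval_path Abs_cpath
proof
  have "continuous_on {0..} (restrict (\<lambda>_. 0 :: real) {0 :: real..})"
    by (rule continuous_on_eq[OF continuous_on_const[of _ 0]]) simp
  then show "restrict (\<lambda>_. 0) {0..} \<in>
      {f :: real \<Rightarrow> real. continuous_on {0..} f \<and> f \<in> extensional {0..}}"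
    by simp
qed

text \<open>The topology of uniform convergence on compact sets: the sets
  $\{g : \sup_{[0,T]} |g - f| < \varepsilon\}$ form a neighbourhood base at $f$.\<close>

instantiation cpath :: topological_space
begin

definition open_cpath :: "cpath set \<Rightarrow> bool" where
  "open_cpath U \<longleftrightarrow>
     (\<forall>f\<in>U. \<exists>T\<ge>0. \<exists>\<epsilon>>0. \<forall>g. (\<forall>t\<in>{0..T}. \<bar>eval_path g t - eval_path f t\<bar> < \<epsilon>) \<longrightarrow> g \<in> U)"

instance
proof
  show "open (UNIV :: cpath set)"
    unfolding open_cpath_def by (auto intro: exI[of _ 0] exI[of _ 1])
next
  fix S T :: "cpath set"
  assume S: "open S" and T: "open T"
  show "open (S \<inter> T)"
    unfolding open_cpath_def
  proof
    fix f assume f: "f \<in> S \<inter> T"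
    obtain A a where A: "A \<ge> 0" "a > 0"
      "\<And>g. (\<forall>t\<in>{0..A}. \<bar>eval_path g t - eval_path f t\<bar> < a) \<Longrightarrow> g \<in> S"
      using S f unfolding open_cpath_def by blast
    obtain B b where B: "B \<ge> 0" "b > 0"
      "\<And>g. (\<forall>t\<in>{0..B}. \<bar>eval_path g t - eval_path f t\<bar> < b) \<Longrightarrow> g \<in> T"
      using T f unfolding open_cpath_def by blast
    have "g \<in> S \<inter> T"
      if "\<forall>t\<in>{0..max A B}. \<bar>eval_path g t - eval_path f t\<bar> < min a b" for g
      using that by (auto intro!: A(3) B(3))
    then show "\<exists>C\<ge>0. \<exists>c>0. \<forall>g.
        (\<forall>t\<in>{0..C}. \<bar>eval_path g t - eval_path f t\<bar> < c) \<longrightarrow> g \<in> S \<inter> T"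
      using A(1,2) B(1,2)
      by (intro exI[of _ "max A B"] conjI exI[of _ "min a b"] allI impI) auto
  qed
next
  fix K :: "cpath set set"
  assume K: "\<forall>S\<in>K. open S"
  show "open (\<Union>K)"
    unfolding open_cpath_def
  proof
    fix f assume "f \<in> \<Union>K"
    then obtain S where S: "S \<in> K" "f \<in> S" by blast
    with K have "open S" by blast
    with S show "\<exists>T\<ge>0. \<exists>\<epsilon>>0. \<forall>g.
        (\<forall>t\<in>{0..T}. \<bar>eval_path g t - eval_path f t\<bar> < \<epsilon>) \<longrightarrow> g \<in> \<Union>K"
      unfolding open_cpath_def by (meson UnionI)
  qed
qed

end

definition path_of :: "(real \<Rightarrow> real) \<Rightarrow> cpath" where
  "path_of f = Abs_cpath (restrict f {0..})"

definition continuous_process :: "'a measure \<Rightarrow> (real \<Rightarrow> 'a \<Rightarrow> real) \<Rightarrow> bool" where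
  "continuous_process M X \<longleftrightarrow> prob_space M \<and>
     (\<forall>\<omega>\<in>space M. continuous_on {0..} (\<lambda>t. X t \<omega>)) \<and>
     (\<lambda>\<omega>. path_of (\<lambda>t. X t \<omega>)) \<in> M \<rightarrow>\<^sub>M borel"

definition path_law :: "'a measure \<Rightarrow> (real \<Rightarrow> 'a \<Rightarrow> real) \<Rightarrow> cpath measure" where
  "path_law M X = distr M borel (\<lambda>\<omega>. path_of (\<lambda>t. X t \<omega>))"

definition weakly_converges ::
    "('i \<Rightarrow> 'p::topological_space measure) \<Rightarrow> 'p measure \<Rightarrow> 'i filter \<Rightarrow> bool" where
  "weakly_converges \<mu> \<nu> F \<longleftrightarrow>
     (\<forall>\<phi> :: 'p \<Rightarrow> real. continuous_on UNIV \<phi> \<and> bounded (range \<phi>) \<longrightarrow>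
        ((\<lambda>i. \<integral>x. \<phi> x \<partial>\<mu> i) \<longlongrightarrow> (\<integral>x. \<phi> x \<partial>\<nu>)) F)"

text \<open>The underlying probability spaces of the approximating processes may vary with the index;
  that the processes are random elements of \<^typ>\<open>cpath\<close> is part of the definition.\<close>

definition converges_in_distribution ::
    "('i \<Rightarrow> 'a measure) \<Rightarrow> ('i \<Rightarrow> real \<Rightarrow> 'a \<Rightarrow> real) \<Rightarrow> 'b measure \<Rightarrow> (real \<Rightarrow> 'b \<Rightarrow> real)
      \<Rightarrow> 'i filter \<Rightarrow> bool" where
  "converges_in_distribution M X N Z F \<longleftrightarrow>
     (\<forall>\<^sub>F i in F. continuous_process (M i) (X i)) \<and> continuous_process N Z \<and>
     weakly_converges (\<lambda>i. path_law (M i) (X i)) (path_law N Z) F"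

definition markov_chain ::
    "'a measure \<Rightarrow> 's set \<Rightarrow> ('s \<Rightarrow> 's \<Rightarrow> real) \<Rightarrow> (nat \<Rightarrow> 'a \<Rightarrow> 's) \<Rightarrow> bool" where
  "markov_chain M S P Y \<longleftrightarrow> prob_space M \<and> (\<forall>n. Y n \<in> M \<rightarrow>\<^sub>M count_space S) \<and>
     (\<forall>n y. (\<forall>i\<le>Suc n. y i \<in> S) \<and> \<P>(\<omega> in M. \<forall>i\<le>n. Y i \<omega> = y i) \<noteq> 0 \<longrightarrow>
        \<P>(\<omega> in M. Y (Suc n) \<omega> = y (Suc n) \<bar> \<forall>i\<le>n. Y i \<omega> = y i) = P (y n) (y (Suc n)))"

definition transition :: "real \<Rightarrow> real \<Rightarrow> real \<Rightarrow> int \<Rightarrow> int \<Rightarrow> real" where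
  "transition c0 c1 dx x y =
     (if x = -1 then if y = -1 then 1 - c0 * dx else c0 * dx
      else if y = -1 then c1 * dx else 1 - c1 * dx)"

definition persistent_walk :: "(nat \<Rightarrow> 'a \<Rightarrow> int) \<Rightarrow> nat \<Rightarrow> 'a \<Rightarrow> int" where
  "persistent_walk Y t \<omega> = (\<Sum>i=0..t. Y i \<omega>)"

text \<open>Meaningful only for times \<open>s\<close> in the grid of nonnegative integer multiples of \<open>dt\<close>,
  where rounding does nothing.\<close>

definition normalized_walk ::
    "real \<Rightarrow> real \<Rightarrow> (nat \<Rightarrow> 'a \<Rightarrow> int) \<Rightarrow> real \<Rightarrow> 'a \<Rightarrow> real" where
  "normalized_walk dx dt Y s \<omega> = dx * real_of_int (persistent_walk Y (nat \<lfloor>s / dt\<rfloor>) \<omega>)"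

text \<open>The linear interpolation of the values of \<open>z\<close> on the grid of multiples of \<open>dt\<close>.\<close>

definition linear_interpolation :: "real \<Rightarrow> (real \<Rightarrow> real) \<Rightarrow> real \<Rightarrow> real" where
  "linear_interpolation dt z s =
     (let k = of_int \<lfloor>s / dt\<rfloor>; \<theta> = s / dt - k
      in (1 - \<theta>) * z (k * dt) + \<theta> * z ((k + 1) * dt))"

definition interpolated_walk ::
    "real \<Rightarrow> real \<Rightarrow> (nat \<Rightarrow> 'a \<Rightarrow> int) \<Rightarrow> real \<Rightarrow> 'a \<Rightarrow> real" where
  "interpolated_walk dx dt Y s \<omega> = linear_interpolation dt (\<lambda>u. normalized_walk dx dt Y u \<omega>) s"

text \<open>Indices start at 1; \<open>e 0\<close> is unconstrained and not used.\<close>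

definition iid_exponential :: "'a measure \<Rightarrow> (nat \<Rightarrow> 'a \<Rightarrow> real) \<Rightarrow> bool" where
  "iid_exponential M e \<longleftrightarrow> prob_space M \<and> prob_space.indep_vars M (\<lambda>_. borel) e {1..} \<and>
     (\<forall>n\<ge>1. distributed M lborel (e n) (exponential_density 1))"

definition jump_scale :: "real \<Rightarrow> real \<Rightarrow> nat \<Rightarrow> real" where
  "jump_scale a b k = (if odd k then 1 / a else 1 / b)"

text \<open>On the null event that infinitely many jumps occur before time \<open>t\<close> the infinite sum is 0
  by convention.\<close>

definition counting_process ::
    "real \<Rightarrow> real \<Rightarrow> (nat \<Rightarrow> 'a \<Rightarrow> real) \<Rightarrow> real \<Rightarrow> 'a \<Rightarrow> nat" where
  "counting_process a b e t \<omega> =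
     (\<Sum>\<^sub>\<infinity>k\<in>{1..}. of_bool ((\<Sum>i=1..k. jump_scale a b i * e i \<omega>) \<le> t))"

definition telegraph_process ::
    "real \<Rightarrow> real \<Rightarrow> (nat \<Rightarrow> 'a \<Rightarrow> real) \<Rightarrow> real \<Rightarrow> 'a \<Rightarrow> real" where
  "telegraph_process a b e t \<omega> = (LBINT u:{0..t}. (-1) ^ counting_process a b e u \<omega>)"

definition poisson_process :: "'a measure \<Rightarrow> real \<Rightarrow> (real \<Rightarrow> 'a \<Rightarrow> nat) \<Rightarrow> bool" where
  "poisson_process M r N \<longleftrightarrow> prob_space M \<and>
     (AE \<omega> in M. N 0 \<omega> = 0 \<and> mono_on {0..} (\<lambda>t. N t \<omega>) \<and>
        (\<forall>t\<ge>0. continuous (at_right t) (\<lambda>u. N u \<omega>))) \<and>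
     (\<forall>n (t :: nat \<Rightarrow> real). 0 \<le> t 0 \<and> (\<forall>i<n. t i \<le> t (Suc i)) \<longrightarrow>
        prob_space.indep_vars M (\<lambda>_. count_space UNIV)
          (\<lambda>i \<omega>. int (N (t (Suc i)) \<omega>) - int (N (t i) \<omega>)) {..<n}) \<and>
     (\<forall>s t. 0 \<le> s \<and> s < t \<longrightarrow>
        distr M (count_space UNIV) (\<lambda>\<omega>. int (N t \<omega>) - int (N s \<omega>)) =
          measure_pmf (map_pmf int (poisson_pmf (r * (t - s)))))"

end

theory Submission
  imports Defs
begin

text \<open>
  The proof is a coupling: for every small step size the walk is rebuilt, with the same law, on the
  probability space of the exponential variables, and there it converges path by path.

  Between two switches the chain waits for a geometric number of steps, and a geometric variable is
  an exponential one rounded up to a grid: if \<open>x\<close> is exponential with mean 1, then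
  \<open>\<lceil>x / - ln (1 - p)\<rceil>\<close> exceeds \<open>k\<close> with probability \<open>(1 - p) ^ k\<close>. With \<open>p = r dx\<close>, where
  \<open>r\<close> is the switching rate of the current state, the sojourn times computed from \<open>e 1, e 2, \<dots>\<close>
  therefore drive a chain whose finite words have the probabilities of the given Markov chain
  (lemma \<open>prob_coupled_chain_word\<close>), hence whose walk has the same law on the path space
  (\<open>path_law_coupled\<close>). Since \<open>- ln (1 - r dx) / dx\<close> tends to \<open>r\<close>, the rescaled switching times
  converge, for almost every outcome, to the partial sums of the \<open>e i / r\<close>, which are the jump times
  of the telegraph process.

  The interpolated walk is, up to its starting value of size \<open>dx\<close>, the integral of the velocity of the
  chain (\<open>interpolated_walk_eq_integral\<close>), just as the telegraph process is the integral of an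
  alternating sign. Convergence of the switching times makes the velocities converge at all but
  countably many times, so their \<open>L\<^sup>1\<close> distance on \<open>[0, T]\<close> tends to 0, and this distance bounds the
  uniform distance of the paths (\<open>coupled_path_tendsto\<close>). Almost sure convergence in the path space
  gives weak convergence by dominated convergence (\<open>converges_in_distribution_telegraph\<close>).

  The same coupling proves the statement on the Poisson process. If both rates are equal to \<open>c\<close>, the
  switches of the coupled chain are independent Bernoulli trials with parameter \<open>c dx\<close>, so the numbers
  of switches in disjoint blocks are independent and binomial. At fixed times these numbers are almost
  surely eventually equal to the increments of the counting process, so independence passes to the
  limit and the binomial laws become Poisson laws (\<open>poisson_process_counting\<close>).
\<close>

section \<open>Random elements of the path space\<close>

lemma eval_path_of:
  assumes "continuous_on {0..} f" and "0 \<le> t"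
  shows "eval_path (path_of f) t = f t"
proof -
  have "continuous_on {0..} (restrict f {0..})"
    by (rule continuous_on_eq[OF assms(1)]) simp
  then show ?thesis
    using assms(2) by (simp add: path_of_def Abs_cpath_inverse)
qed

text \<open>Every neighbourhood of a path contains a uniform tube around it over some \<open>[0, T]\<close>, so uniform
  closeness on each \<open>[0, T]\<close> is all that convergence in the path space asks for.\<close>

lemma tendsto_path_of:
  fixes X :: "'i \<Rightarrow> real \<Rightarrow> real"
  assumes cont: "\<And>i. continuous_on {0..} (X i)" "continuous_on {0..} Z"
    and close: "\<And>T \<epsilon>. 0 \<le> T \<Longrightarrow> 0 < \<epsilon> \<Longrightarrow> \<forall>\<^sub>F i in F. \<forall>t\<in>{0..T}. \<bar>X i t - Z t\<bar> < \<epsilon>"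
  shows "((\<lambda>i. path_of (X i)) \<longlongrightarrow> path_of Z) F"
proof (rule topological_tendstoI)
  fix U :: "cpath set"
  assume "open U" "path_of Z \<in> U"
  then obtain T \<epsilon> where T: "0 \<le> T" "0 < \<epsilon>"
    and U: "\<And>g. (\<forall>t\<in>{0..T}. \<bar>eval_path g t - eval_path (path_of Z) t\<bar> < \<epsilon>) \<Longrightarrow> g \<in> U"
    unfolding open_cpath_def by meson
  from close[OF T] show "\<forall>\<^sub>F i in F. path_of (X i) \<in> U"
    by eventually_elim (auto intro!: U simp: eval_path_of cont)
qed

text \<open>All paths that occur below are, up to a constant, integrals of functions bounded by 1. Their common Lipschitz
  constant replaces the separability of the path space in the measurability proof.\<close>

definition unit_speed :: "(real \<Rightarrow> real) \<Rightarrow> bool" where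
  "unit_speed f \<longleftrightarrow> (\<forall>s\<ge>0. \<forall>t\<ge>0. \<bar>f t - f s\<bar> \<le> \<bar>t - s\<bar>)"

lemma unit_speed_continuous:
  assumes "unit_speed f"
  shows "continuous_on {0..} f"
proof -
  have "1-lipschitz_on {0..} f"
    by (rule lipschitz_onI)
       (use assms in \<open>auto simp: unit_speed_def dist_real_def\<close>)
  then show ?thesis
    by (rule lipschitz_on_continuous_on)
qed

text \<open>The integer parts of the values of \<open>m f\<close> at the points \<open>k / m\<close> of \<open>[0, m)\<close>: a path of unit
  speed is determined by this finite list up to an error of order \<open>1 / m\<close>.\<close>

definition grid_levels :: "nat \<Rightarrow> (real \<Rightarrow> real) \<Rightarrow> int list" where
  "grid_levels m f = map (\<lambda>k. \<lfloor>real m * f (real k / real m)\<rfloor>) [0..<m * m]"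

lemma grid_levels_close:
  assumes f: "unit_speed f" and g: "unit_speed g" and m: "0 < m"
    and eq: "grid_levels m f = grid_levels m g"
    and t: "0 \<le> t" "t < real m"
  shows "\<bar>g t - f t\<bar> < 3 / real m"
proof -
  define k where "k = nat \<lfloor>t * real m\<rfloor>"
  have k: "real k \<le> t * real m" "t * real m < real k + 1"
  proof -
    have "0 \<le> t * real m"
      using t by simp
    then show "real k \<le> t * real m" "t * real m < real k + 1"
      unfolding k_def by linarith+
  qed
  have "real k < real m * real m"
    using k(1) t m by (smt (verit) mult_strict_right_mono of_nat_0_less_iff)
  then have "k < m * m"
    by (metis of_nat_less_iff of_nat_mult)
  moreover define u where "u = real k / real m"
  ultimately have "\<lfloor>real m * f u\<rfloor> = \<lfloor>real m * g u\<rfloor>"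
    using eq by (simp add: grid_levels_def u_def)
  then have "\<bar>real m * g u - real m * f u\<bar> < 1"
    by linarith
  also have "\<bar>real m * g u - real m * f u\<bar> = real m * \<bar>g u - f u\<bar>"
    by (simp add: abs_mult right_diff_distrib flip: right_diff_distrib)
  finally have "\<bar>g u - f u\<bar> < 1 / real m"
    using m by (simp add: field_simps)
  moreover have u: "0 \<le> u" "\<bar>t - u\<bar> \<le> 1 / real m"
  proof -
    have "u \<le> t" "t < (real k + 1) / real m"
      using k m by (auto simp: u_def field_simps)
    then show "0 \<le> u" "\<bar>t - u\<bar> \<le> 1 / real m"
      by (auto simp: u_def add_divide_distrib)
  qed
  moreover have "\<bar>g t - g u\<bar> \<le> \<bar>t - u\<bar>" "\<bar>f t - f u\<bar> \<le> \<bar>t - u\<bar>"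
    using f g u t unfolding unit_speed_def by blast+
  moreover have "3 / real m = 1 / real m + 1 / real m + 1 / real m"
    by simp
  ultimately show ?thesis
    by linarith
qed

text \<open>A path of unit speed lies in an open set \<open>U\<close> if and only if, for some \<open>m\<close>, every path of unit
  speed with the same list of grid levels lies in \<open>U\<close>. The lists are countably many and depend
  measurably on the outcome, so the preimage of \<open>U\<close> is a countable union of events.\<close>

lemma unit_speed_process_measurable:
  assumes meas: "\<And>t. 0 \<le> t \<Longrightarrow> X t \<in> borel_measurable M"
    and X: "\<And>\<omega>. \<omega> \<in> space M \<Longrightarrow> unit_speed (\<lambda>t. X t \<omega>)"
  shows "(\<lambda>\<omega>. path_of (\<lambda>t. X t \<omega>)) \<in> M \<rightarrow>\<^sub>M borel"
proof (rule borel_measurableI)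
  fix U :: "cpath set"
  assume U: "open U"
  let ?D = "\<lambda>m \<omega>. grid_levels m (\<lambda>t. X t \<omega>)"
  define V where "V m = {v. \<forall>f. unit_speed f \<and> grid_levels m f = v \<longrightarrow> path_of f \<in> U}" for m
  have D: "?D m \<in> M \<rightarrow>\<^sub>M count_space UNIV" for m
  proof -
    have [measurable]: "X (real k / real m) \<in> borel_measurable M" for k
      by (rule meas) simp
    have [measurable]: "Measurable.pred M (\<lambda>\<omega>. ?D m \<omega> = v)" for v
      by (simp add: grid_levels_def list_eq_iff_nth_eq)
    show ?thesis
      by (rule measurable_count_space_eq2_countable[THEN iffD2])
         (auto simp: vimage_def Int_def conj_commute intro: pred_def[THEN iffD1])
  qed
  have "path_of (\<lambda>t. X t \<omega>) \<in> U \<longleftrightarrow> (\<exists>m. ?D m \<omega> \<in> V m)" if \<omega>: "\<omega> \<in> space M" for \<omega>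
  proof
    assume "path_of (\<lambda>t. X t \<omega>) \<in> U"
    then obtain T \<epsilon> where T: "0 \<le> T" "0 < \<epsilon>"
      and U': "\<And>g. (\<forall>t\<in>{0..T}. \<bar>eval_path g t - eval_path (path_of (\<lambda>t. X t \<omega>)) t\<bar> < \<epsilon>) \<Longrightarrow> g \<in> U"
      using U unfolding open_cpath_def by meson
    obtain m :: nat where m: "max (T + 1) (3 / \<epsilon>) < real m"
      using reals_Archimedean2 by blast
    then have m0: "0 < m" and mT: "T < real m" and "3 / \<epsilon> < real m"
      using T by (auto intro: gr0I)
    then have m3: "3 / real m < \<epsilon>"
      using T by (simp add: field_simps)
    have "path_of f \<in> U" if f: "unit_speed f" "grid_levels m f = ?D m \<omega>" for f
    proof (rule U', rule ballI)
      fix t assume t: "t \<in> {0..T}"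
      then have "\<bar>f t - X t \<omega>\<bar> < 3 / real m"
        using grid_levels_close[OF X[OF \<omega>] f(1) m0 f(2)[symmetric], of t] mT by auto
      then show "\<bar>eval_path (path_of f) t - eval_path (path_of (\<lambda>t. X t \<omega>)) t\<bar> < \<epsilon>"
        using t m3 by (simp add: eval_path_of unit_speed_continuous f X \<omega>)
    qed
    then show "\<exists>m. ?D m \<omega> \<in> V m"
      by (auto simp: V_def)
  next
    assume "\<exists>m. ?D m \<omega> \<in> V m"
    then show "path_of (\<lambda>t. X t \<omega>) \<in> U"
      using X[OF \<omega>] by (auto simp: V_def)
  qed
  then have "(\<lambda>\<omega>. path_of (\<lambda>t. X t \<omega>)) -` U \<inter> space M = (\<Union>m. ?D m -` V m \<inter> space M)"
    by auto
  also have "\<dots> \<in> sets M"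
    using D by (auto intro!: sets.countable_UN measurable_sets[OF D])
  finally show "(\<lambda>\<omega>. path_of (\<lambda>t. X t \<omega>)) -` U \<inter> space M \<in> sets M" .
qed

lemma set_integrable_Icc_bounded:
  fixes h :: "real \<Rightarrow> real"
  assumes "h \<in> borel_measurable borel" "\<And>u. \<bar>h u\<bar> \<le> 1"
  shows "set_integrable lborel {a..b} h"
proof (rule set_integrable_bound[where f = "\<lambda>_. 1::real"])
  show "set_integrable lborel {a..b} (\<lambda>_. 1::real)"
    by (simp add: set_integrable_def emeasure_lborel_Icc_eq)
qed (use assms in \<open>auto simp: set_borel_measurable_def\<close>)

lemma set_integral_Icc_split:
  fixes h :: "real \<Rightarrow> real"
  assumes h: "h \<in> borel_measurable borel" "\<And>u. \<bar>h u\<bar> \<le> 1" and st: "0 \<le> s" "s \<le> t"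
  shows "(LBINT u:{0..t}. h u) = (LBINT u:{0..s}. h u) + (LBINT u:{s<..t}. h u)"
proof -
  have "{0..t} = {0..s} \<union> {s<..t}"
    using st by auto
  moreover have "(LBINT u:{0..s} \<union> {s<..t}. h u) = (LBINT u:{0..s}. h u) + (LBINT u:{s<..t}. h u)"
    by (rule set_integral_Un)
       (use st in \<open>auto intro: set_integrable_Icc_bounded[OF h] set_integrable_subset[OF set_integrable_Icc_bounded[OF h, of s t]]\<close>)
  ultimately show ?thesis by simp
qed

lemma unit_speed_integral:
  fixes h :: "real \<Rightarrow> real"
  assumes h: "h \<in> borel_measurable borel" "\<And>u. \<bar>h u\<bar> \<le> 1"
  shows "unit_speed (\<lambda>t. c + (LBINT u:{0..t}. h u))"
proof -
  have *: "\<bar>(LBINT u:{0..t}. h u) - (LBINT u:{0..s}. h u)\<bar> \<le> t - s" if st: "0 \<le> s" "s \<le> t" for s t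
  proof -
    have i: "set_integrable lborel {s<..t} h"
      by (rule set_integrable_subset[OF set_integrable_Icc_bounded[OF h, of s t]]) auto
    have "\<bar>(LBINT u:{s<..t}. h u)\<bar> \<le> (LBINT u:{s<..t}. \<bar>h u\<bar>)"
      using set_integral_norm_bound[OF i] by simp
    also have "\<dots> \<le> (LBINT u:{s<..t}. 1)"
      by (rule set_integral_mono[OF set_integrable_abs[OF i]])
         (use h st in \<open>auto simp: set_integrable_def emeasure_lborel_Ioc\<close>)
    also have "\<dots> = t - s"
      using st by (simp add: set_lebesgue_integral_def)
    finally show ?thesis
      by (simp add: set_integral_Icc_split[OF h st])
  qed
  show ?thesis
    unfolding unit_speed_def
  proof (intro allI impI)
    fix s t :: real assume "0 \<le> s" "0 \<le> t"
    then show "\<bar>c + (LBINT u:{0..t}. h u) - (c + (LBINT u:{0..s}. h u))\<bar> \<le> \<bar>t - s\<bar>"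
      using *[of s t] *[of t s] by (cases "s \<le> t") (auto simp: abs_minus_commute)
  qed
qed

section \<open>The interpolated walk as the integral of a velocity\<close>

text \<open>At time \<open>u\<close> the interpolated walk moves from its value number \<open>\<lfloor>u / dx\<rfloor>\<close> to the next one,
  hence the index shift by 1.\<close>

definition velocity :: "real \<Rightarrow> (nat \<Rightarrow> int) \<Rightarrow> real \<Rightarrow> real" where
  "velocity dx y u = real_of_int (y (nat \<lfloor>u / dx\<rfloor> + 1))"

lemma velocity_measurable [measurable]: "velocity dx y \<in> borel_measurable borel"
proof -
  \<comment> \<open>An arbitrary function of a measurable integer-valued function is measurable.\<close>
  have "(\<lambda>u. nat \<lfloor>u / dx\<rfloor>) \<in> borel \<rightarrow>\<^sub>M count_space UNIV"
    by measurable
  then show ?thesis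
    unfolding velocity_def[abs_def]
    by (rule measurable_compose[where g = "\<lambda>n. real_of_int (y (n + 1))"]) simp
qed

lemma abs_velocity_le:
  assumes "\<And>i. \<bar>y i\<bar> \<le> 1"
  shows "\<bar>velocity dx y u\<bar> \<le> 1"
proof -
  have "real_of_int \<bar>y i\<bar> \<le> 1" for i
    using assms[of i] by linarith
  then show ?thesis
    by (simp add: velocity_def)
qed

lemma velocity_integral_piece:
  assumes dx: "0 < dx" and s: "real n * dx \<le> s" "s \<le> real (Suc n) * dx"
  shows "(LBINT u:{real n * dx<..s}. velocity dx y u) = (s - real n * dx) * real_of_int (y (Suc n))"
proof -
  \<comment> \<open>Only the right end of the grid cell, a null set, belongs to the next cell.\<close>
  have "velocity dx y u = real_of_int (y (Suc n))"
    if "u \<in> {real n * dx<..s}" "u \<noteq> real (Suc n) * dx" for u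
  proof -
    have "real n * dx < u" "u < real (Suc n) * dx"
      using that s by auto
    then have "real n < u / dx" "u / dx < real (Suc n)"
      using dx by (auto simp: field_simps)
    then have "\<lfloor>u / dx\<rfloor> = int n"
      by linarith
    then show ?thesis
      by (simp add: velocity_def)
  qed
  then have "(LBINT u:{real n * dx<..s}. velocity dx y u)
      = (LBINT u:{real n * dx<..s}. real_of_int (y (Suc n)))"
    by (intro set_lebesgue_integral_cong_AE)
       (auto intro!: eventually_mono[OF AE_lborel_singleton[of "real (Suc n) * dx"]])
  also have "\<dots> = (s - real n * dx) * real_of_int (y (Suc n))"
    using s by (simp add: set_lebesgue_integral_def)
  finally show ?thesis .
qed

lemma velocity_integral_grid:
  assumes dx: "0 < dx" and y: "\<And>i. \<bar>y i\<bar> \<le> 1"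
  shows "(LBINT u:{0..real n * dx}. velocity dx y u) = dx * real_of_int (\<Sum>i=1..n. y i)"
proof (induction n)
  case 0
  have "(LBINT u:{0..0}. velocity dx y u) = 0"
    unfolding set_lebesgue_integral_def
    by (subst integral_cong_AE[where g = "\<lambda>_. 0"])
       (auto intro!: eventually_mono[OF AE_lborel_singleton[of 0]])
  then show ?case by simp
next
  case (Suc n)
  have "(LBINT u:{0..real (Suc n) * dx}. velocity dx y u)
      = (LBINT u:{0..real n * dx}. velocity dx y u)
        + (LBINT u:{real n * dx<..real (Suc n) * dx}. velocity dx y u)"
    by (rule set_integral_Icc_split) (use dx in \<open>auto intro: abs_velocity_le y\<close>)
  also have "(LBINT u:{real n * dx<..real (Suc n) * dx}. velocity dx y u)
      = (real (Suc n) * dx - real n * dx) * real_of_int (y (Suc n))"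
    by (rule velocity_integral_piece[OF dx]) (use dx in auto)
  finally show ?case
    unfolding Suc.IH by (simp add: algebra_simps)
qed

text \<open>With equal space and time steps, the slope of each step of the walk is the state of the chain.
  The initial value \<open>dx * Y 0\<close> is there because the walk starts at \<open>Y 0\<close> and not at 0.\<close>

lemma interpolated_walk_eq_integral:
  assumes dx: "0 < dx" and s: "0 \<le> s" and y: "\<And>i. \<bar>Y i \<omega>\<bar> \<le> 1"
  shows "interpolated_walk dx dx Y s \<omega>
      = dx * real_of_int (Y 0 \<omega>) + (LBINT u:{0..s}. velocity dx (\<lambda>i. Y i \<omega>) u)"
proof -
  define n where "n = nat \<lfloor>s / dx\<rfloor>"
  have fl: "\<lfloor>s / dx\<rfloor> = int n"
    using dx s by (simp add: n_def)
  have "real n \<le> s / dx" "s / dx < real (Suc n)"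
    using fl by linarith+
  then have n: "real n * dx \<le> s" "s \<le> real (Suc n) * dx"
    using dx by (simp_all add: field_simps)
  have W: "normalized_walk dx dx Y (real m * dx) \<omega> = dx * real_of_int (\<Sum>i=0..m. Y i \<omega>)" for m
    using dx by (simp add: normalized_walk_def persistent_walk_def)
  define \<theta> where "\<theta> = s / dx - real n"
  have \<theta>: "\<theta> * dx = s - real n * dx"
    using dx by (simp add: \<theta>_def left_diff_distrib)
  have "real_of_int \<lfloor>s / dx\<rfloor> = real n"
    by (simp add: fl)
  then have "interpolated_walk dx dx Y s \<omega>
      = (1 - \<theta>) * normalized_walk dx dx Y (real n * dx) \<omega>
        + \<theta> * normalized_walk dx dx Y ((real n + 1) * dx) \<omega>"
    by (simp only: interpolated_walk_def linear_interpolation_def Let_def \<theta>_def)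
  also have "real n + 1 = real (Suc n)"
    by simp
  also have "(1 - \<theta>) * normalized_walk dx dx Y (real n * dx) \<omega>
        + \<theta> * normalized_walk dx dx Y (real (Suc n) * dx) \<omega>
      = dx * real_of_int (\<Sum>i=0..n. Y i \<omega>) + \<theta> * dx * real_of_int (Y (Suc n) \<omega>)"
    unfolding W sum.atLeast0_atMost_Suc of_int_add by algebra
  also note \<theta>
  also have "dx * real_of_int (\<Sum>i=0..n. Y i \<omega>) + (s - real n * dx) * real_of_int (Y (Suc n) \<omega>)
      = dx * real_of_int (Y 0 \<omega>)
      + (LBINT u:{0..real n * dx}. velocity dx (\<lambda>i. Y i \<omega>) u)
      + (LBINT u:{real n * dx<..s}. velocity dx (\<lambda>i. Y i \<omega>) u)"
    by (simp only: velocity_integral_grid[OF dx y] velocity_integral_piece[OF dx n])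
       (simp add: sum.atLeast_Suc_atMost algebra_simps)
  also have "\<dots> = dx * real_of_int (Y 0 \<omega>) + (LBINT u:{0..s}. velocity dx (\<lambda>i. Y i \<omega>) u)"
    by (subst set_integral_Icc_split[where s = "real n * dx" and t = s])
       (use dx n in \<open>auto intro: abs_velocity_le y\<close>)
  finally show ?thesis .
qed

lemma unit_speed_interpolated_walk:
  assumes dx: "0 < dx" and y: "\<And>i. \<bar>Y i \<omega>\<bar> \<le> 1"
  shows "unit_speed (\<lambda>s. interpolated_walk dx dx Y s \<omega>)"
proof -
  have "unit_speed (\<lambda>s. dx * real_of_int (Y 0 \<omega>) + (LBINT u:{0..s}. velocity dx (\<lambda>i. Y i \<omega>) u))"
    by (rule unit_speed_integral) (auto intro: abs_velocity_le y)
  then show ?thesis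
    by (simp add: unit_speed_def interpolated_walk_eq_integral[where Y = Y and \<omega> = \<omega>, OF dx _ y])
qed

lemma interpolated_walk_measurable:
  assumes [measurable]: "\<And>n. Y n \<in> M \<rightarrow>\<^sub>M count_space UNIV"
  shows "interpolated_walk dx dx Y s \<in> borel_measurable M"
  unfolding interpolated_walk_def[abs_def] linear_interpolation_def normalized_walk_def
    persistent_walk_def Let_def of_int_sum
  by measurable

lemma interpolated_walk_path_measurable:
  assumes dx: "0 < dx" and Y: "\<And>n. Y n \<in> M \<rightarrow>\<^sub>M count_space {-1, 1}"
  shows "(\<lambda>\<omega>. path_of (\<lambda>s. interpolated_walk dx dx Y s \<omega>)) \<in> M \<rightarrow>\<^sub>M borel"
proof (rule unit_speed_process_measurable)
  have "Y n \<in> M \<rightarrow>\<^sub>M count_space UNIV" for n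
    using Y[of n] by (rule measurable_compose[where g = "\<lambda>x. x"]) (simp add: measurable_count_space_eq1)
  then show "interpolated_walk dx dx Y t \<in> borel_measurable M" for t
    by (rule interpolated_walk_measurable)
  show "unit_speed (\<lambda>s. interpolated_walk dx dx Y s \<omega>)" if "\<omega> \<in> space M" for \<omega>
  proof (rule unit_speed_interpolated_walk[OF dx])
    show "\<bar>Y i \<omega>\<bar> \<le> 1" for i
      using measurable_space[OF Y that, of i] by auto
  qed
qed

section \<open>Laws of discrete sequences\<close>

text \<open>Every finite-dimensional cylinder is a finite disjoint union of the events that fix a whole
  initial segment of the sequence, so the probabilities of the latter determine the law.\<close>

lemma distr_sequence_eqI:
  fixes X :: "nat \<Rightarrow> 'a \<Rightarrow> 's" and Z :: "nat \<Rightarrow> 'b \<Rightarrow> 's"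
  assumes M: "prob_space M" and N: "prob_space N" and S: "finite S"
    and X: "\<And>n. X n \<in> M \<rightarrow>\<^sub>M count_space S" and Z: "\<And>n. Z n \<in> N \<rightarrow>\<^sub>M count_space S"
    and eq: "\<And>n w. (\<And>i. i \<le> n \<Longrightarrow> w i \<in> S) \<Longrightarrow>
      \<P>(\<omega> in M. \<forall>i\<le>n. X i \<omega> = w i) = \<P>(\<omega> in N. \<forall>i\<le>n. Z i \<omega> = w i)"
  shows "distr M (PiM UNIV (\<lambda>_. count_space S)) (\<lambda>\<omega> n. X n \<omega>)
    = distr N (PiM UNIV (\<lambda>_. count_space S)) (\<lambda>\<omega> n. Z n \<omega>)"
proof -
  interpret M: prob_space M by fact
  interpret N: prob_space N by fact
  define Q where "Q = PiM (UNIV :: nat set) (\<lambda>_. count_space S)"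
  define W where "W J A = {w \<in> PiE {..Max (insert 0 J)} (\<lambda>_. S). \<forall>j\<in>J. w j \<in> A j}"
    for J :: "nat set" and A :: "nat \<Rightarrow> 's set"
  have cylinder: "measure L ((\<lambda>\<omega> n. V n \<omega>) -` prod_emb UNIV (\<lambda>_. count_space S) J (Pi\<^sub>E J A) \<inter> space L)
      = (\<Sum>w\<in>W J A. \<P>(\<omega> in L. \<forall>i\<le>Max (insert 0 J). V i \<omega> = w i))"
    if L: "prob_space L" and V: "\<And>n. V n \<in> L \<rightarrow>\<^sub>M count_space S" and J: "finite J"
    for L :: "'c measure" and V J A
  proof -
    interpret L: prob_space L by fact
    let ?m = "Max (insert 0 J)"
    have Jm: "j \<le> ?m" if "j \<in> J" for j
      using that J by simp
    have [measurable]: "{\<omega> \<in> space L. V i \<omega> = c} \<in> sets L" for i c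
    proof (cases "c \<in> S")
      case True
      then show ?thesis
        using measurable_sets[OF V, of "{c}" i] by (simp add: vimage_def Int_def conj_commute)
    next
      case False
      then have "{\<omega> \<in> space L. V i \<omega> = c} = {}"
        using measurable_space[OF V, of _ i] by auto
      then show ?thesis by (simp only: sets.empty_sets)
    qed
    have fin: "finite (W J A)"
      unfolding W_def by (rule finite_subset[of _ "PiE {..?m} (\<lambda>_. S)"]) (auto intro: finite_PiE S)
    have "((\<lambda>\<omega> n. V n \<omega>) -` prod_emb UNIV (\<lambda>_. count_space S) J (Pi\<^sub>E J A) \<inter> space L)
        = {\<omega> \<in> space L. \<forall>j\<in>J. V j \<omega> \<in> A j}"
      using measurable_space[OF V] by (auto simp: prod_emb_def space_PiM PiE_iff)
    also have "\<dots> = (\<Union>w\<in>W J A. {\<omega> \<in> space L. \<forall>i\<le>?m. V i \<omega> = w i})"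
    proof (intro equalityI subsetI)
      fix \<omega> assume \<omega>: "\<omega> \<in> {\<omega> \<in> space L. \<forall>j\<in>J. V j \<omega> \<in> A j}"
      then have "restrict (\<lambda>i. V i \<omega>) {..?m} \<in> W J A"
        using measurable_space[OF V, of \<omega>] Jm by (auto simp: W_def)
      then show "\<omega> \<in> (\<Union>w\<in>W J A. {\<omega> \<in> space L. \<forall>i\<le>?m. V i \<omega> = w i})"
        using \<omega> by (intro UN_I[of "restrict (\<lambda>i. V i \<omega>) {..?m}"]) auto
    qed (auto simp: W_def dest: Jm)
    also have "measure L \<dots> = (\<Sum>w\<in>W J A. measure L {\<omega> \<in> space L. \<forall>i\<le>?m. V i \<omega> = w i})"
    proof (rule L.finite_measure_finite_Union[OF fin])
      show "(\<lambda>w. {\<omega> \<in> space L. \<forall>i\<le>?m. V i \<omega> = w i}) ` W J A \<subseteq> sets L"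
        by auto
      show "disjoint_family_on (\<lambda>w. {\<omega> \<in> space L. \<forall>i\<le>?m. V i \<omega> = w i}) (W J A)"
        unfolding disjoint_family_on_def
      proof (intro ballI impI)
        fix v w assume vw: "v \<in> W J A" "w \<in> W J A" "v \<noteq> w"
        have "\<exists>i\<le>?m. v i \<noteq> w i"
        proof (rule ccontr)
          assume "\<not> (\<exists>i\<le>?m. v i \<noteq> w i)"
          then have "v = w"
            using vw(1,2) by (intro PiE_ext[of v "{..?m}" "\<lambda>_. S" w]) (simp_all add: W_def)
          with vw(3) show False by simp
        qed
        then show "{\<omega> \<in> space L. \<forall>i\<le>?m. V i \<omega> = v i} \<inter> {\<omega> \<in> space L. \<forall>i\<le>?m. V i \<omega> = w i} = {}"
          by auto
      qed
    qed
    finally show ?thesis .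
  qed
  have meas: "(\<lambda>\<omega> n. V n \<omega>) \<in> L \<rightarrow>\<^sub>M Q" if "\<And>n. V n \<in> L \<rightarrow>\<^sub>M count_space S"
    for L :: "'c measure" and V
    unfolding Q_def using measurable_space[OF that]
    by (intro measurable_PiM_single') (auto intro: that)
  have "distr M Q (\<lambda>\<omega> n. X n \<omega>) = distr N Q (\<lambda>\<omega> n. Z n \<omega>)"
  proof (rule measure_eqI_PiM_infinite)
    show "sets (distr M Q (\<lambda>\<omega> n. X n \<omega>)) = sets (PiM UNIV (\<lambda>_. count_space S))"
      "sets (distr N Q (\<lambda>\<omega> n. Z n \<omega>)) = sets (PiM UNIV (\<lambda>_. count_space S))"
      by (simp_all add: Q_def)
    show "finite_measure (distr M Q (\<lambda>\<omega> n. X n \<omega>))"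
      using prob_space.prob_space_distr[OF M meas[OF X]] by (simp add: prob_space.finite_measure)
    fix A and J :: "nat set"
    assume J: "finite J" and A: "\<And>i. i \<in> J \<Longrightarrow> A i \<in> sets (count_space S)"
    let ?E = "prod_emb UNIV (\<lambda>_. count_space S) J (Pi\<^sub>E J A)"
    have E: "?E \<in> sets Q"
      unfolding Q_def using J A by (intro sets_PiM_I) auto
    have "measure M ((\<lambda>\<omega> n. X n \<omega>) -` ?E \<inter> space M) = measure N ((\<lambda>\<omega> n. Z n \<omega>) -` ?E \<inter> space N)"
      unfolding cylinder[OF M X J] cylinder[OF N Z J]
      by (rule sum.cong[OF refl], rule eq) (auto simp: W_def PiE_iff)
    then show "emeasure (distr M Q (\<lambda>\<omega> n. X n \<omega>)) ?E = emeasure (distr N Q (\<lambda>\<omega> n. Z n \<omega>)) ?E"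
      by (simp add: emeasure_distr meas X Z E M.emeasure_eq_measure N.emeasure_eq_measure)
  qed
  then show ?thesis by (simp add: Q_def)
qed

text \<open>Where the conditioning event is null the transition rule says nothing, but then the longer
  word has probability 0 as well, and so has the product by induction.\<close>

lemma markov_chain_prefix:
  assumes mc: "markov_chain M S P Y" and start: "AE \<omega> in M. Y 0 \<omega> = s"
    and y: "\<And>i. i \<le> n \<Longrightarrow> y i \<in> S"
  shows "\<P>(\<omega> in M. \<forall>i\<le>n. Y i \<omega> = y i) = of_bool (y 0 = s) * (\<Prod>i<n. P (y i) (y (Suc i)))"
proof -
  interpret prob_space M
    using mc by (simp add: markov_chain_def)
  have Y: "Y i \<in> M \<rightarrow>\<^sub>M count_space S" for i
    using mc by (simp add: markov_chain_def)
  have step: "\<P>(\<omega> in M. Y (Suc n) \<omega> = y (Suc n) \<bar> \<forall>i\<le>n. Y i \<omega> = y i) = P (y n) (y (Suc n))"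
    if "\<forall>i\<le>Suc n. y i \<in> S" "\<P>(\<omega> in M. \<forall>i\<le>n. Y i \<omega> = y i) \<noteq> 0" for n y
    using mc that by (simp add: markov_chain_def)
  have [measurable]: "{\<omega> \<in> space M. Y i \<omega> = c} \<in> sets M" if "c \<in> S" for i c
    using measurable_sets[OF Y, of "{c}" i] that by (simp add: vimage_def Int_def conj_commute)
  show ?thesis
    using y
  proof (induction n)
    case 0
    have "\<P>(\<omega> in M. \<forall>i\<le>(0::nat). Y i \<omega> = y i) = measure M {\<omega> \<in> space M. s = y 0}"
      using start 0 by (intro finite_measure_eq_AE) (auto elim: eventually_mono)
    then show ?case
      by (auto simp: prob_space)
  next
    case (Suc n)
    let ?A = "{\<omega> \<in> space M. \<forall>i\<le>n. Y i \<omega> = y i}" and ?B = "{\<omega> \<in> space M. \<forall>i\<le>Suc n. Y i \<omega> = y i}"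
    have IH: "measure M ?A = of_bool (y 0 = s) * (\<Prod>i<n. P (y i) (y (Suc i)))"
      using Suc by simp
    have BA: "?B = {\<omega> \<in> space M. Y (Suc n) \<omega> = y (Suc n) \<and> (\<forall>i\<le>n. Y i \<omega> = y i)}"
      by (auto simp: le_Suc_eq)
    show ?case
    proof (cases "measure M ?A = 0")
      case True
      have "measure M ?B \<le> measure M ?A"
        using Suc.prems by (intro finite_measure_mono) (auto intro!: sets.sets_Collect_finite_All')
      then show ?thesis
        using True IH by (auto simp: measure_le_0_iff)
    next
      case False
      have "measure M ?B / measure M ?A = P (y n) (y (Suc n))"
        using step[of n y] Suc.prems False by (auto simp: cond_prob_def BA)
      then have "measure M ?B = measure M ?A * P (y n) (y (Suc n))"
        using False by (simp add: field_simps)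
      then show ?thesis
        using IH by simp
    qed
  qed
qed

section \<open>Chains built from sojourn times\<close>

text \<open>The times at which a chain with consecutive sojourn times \<open>g 1, g 2, \<dots>\<close> changes its state.\<close>

definition switches :: "(nat \<Rightarrow> nat) \<Rightarrow> nat \<Rightarrow> bool" where
  "switches g n \<longleftrightarrow> (\<exists>k\<ge>1. (\<Sum>i=1..k. g i) = n)"

definition switch_count :: "(nat \<Rightarrow> bool) \<Rightarrow> nat \<Rightarrow> nat" where
  "switch_count b n = card {i \<in> {1..n}. b i}"

lemma switch_count_0 [simp]: "switch_count b 0 = 0"
  by (simp add: switch_count_def)

lemma switch_count_Suc: "switch_count b (Suc n) = switch_count b n + of_bool (b (Suc n))"
proof -
  have "{i \<in> {1..Suc n}. b i} = (if b (Suc n) then insert (Suc n) {i \<in> {1..n}. b i} else {i \<in> {1..n}. b i})"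
    by (auto simp: le_Suc_eq)
  then show ?thesis
    by (simp add: switch_count_def)
qed

text \<open>While the chain is in its sojourn number \<open>k + 1\<close>, the next step is a switch exactly when it
  completes that sojourn: sojourns last at least one step, so no other partial sum can hit \<open>n + 1\<close>.\<close>

lemma switches_Suc_iff:
  assumes g: "\<And>i. 1 \<le> g i" and n: "(\<Sum>i=1..k. g i) \<le> n" "n < (\<Sum>i=1..Suc k. g i)"
  shows "switches g (Suc n) \<longleftrightarrow> (\<Sum>i=1..Suc k. g i) = Suc n"
proof
  assume "switches g (Suc n)"
  then obtain j where j: "(\<Sum>i=1..j. g i) = Suc n"
    by (auto simp: switches_def)
  have mono: "(\<Sum>i=1..j. g i) \<le> (\<Sum>i=1..j'. g i)" if "j \<le> j'" for j j'
    by (rule sum_mono2) (use that in auto)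
  have "\<not> j \<le> k"
    using mono[of j k] j n by auto
  moreover have "\<not> Suc (Suc k) \<le> j"
    using mono[of "Suc (Suc k)" j] j n g[of "Suc (Suc k)"] by auto
  ultimately have "j = Suc k"
    by simp
  with j show "(\<Sum>i=1..Suc k. g i) = Suc n"
    by simp
qed (unfold switches_def, intro exI[of _ "Suc k"], simp)

lemma (in prob_space) prob_indep_prefix:
  assumes ind: "indep_vars (\<lambda>_. count_space UNIV) G {1..}"
  shows "\<P>(\<omega> in M. (\<forall>i\<in>{1..k}. G i \<omega> = r i) \<and> G (Suc k) \<omega> \<in> C)
    = (\<Prod>i=1..k. \<P>(\<omega> in M. G i \<omega> = r i)) * \<P>(\<omega> in M. G (Suc k) \<omega> \<in> C)"
proof -
  let ?A = "\<lambda>i. if i \<le> k then {r i} else C"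
  have "{\<omega> \<in> space M. (\<forall>i\<in>{1..k}. G i \<omega> = r i) \<and> G (Suc k) \<omega> \<in> C}
      = (\<Inter>i\<in>{1..Suc k}. G i -` ?A i \<inter> space M)"
    by (auto simp: atLeastAtMostSuc_conv split: if_splits)
  also have "prob \<dots> = (\<Prod>i\<in>{1..Suc k}. prob (G i -` ?A i \<inter> space M))"
    by (rule indep_varsD[OF ind]) auto
  also have "\<dots> = (\<Prod>i\<in>{1..k}. prob (G i -` ?A i \<inter> space M)) * prob (G (Suc k) -` C \<inter> space M)"
    by simp
  also have "(\<Prod>i\<in>{1..k}. prob (G i -` ?A i \<inter> space M)) = (\<Prod>i=1..k. \<P>(\<omega> in M. G i \<omega> = r i))"
    by (rule prod.cong) (auto intro!: arg_cong[where f = prob])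
  also have "G (Suc k) -` C \<inter> space M = {\<omega> \<in> space M. G (Suc k) \<omega> \<in> C}"
    by auto
  finally show ?thesis .
qed

text \<open>Prescribing the switches up to time \<open>n\<close> amounts to prescribing the lengths of the completed
  sojourns and saying that the current one exceeds its present age \<open>a\<close>. This description has the
  right probability by independence, and it is maintained from \<open>n\<close> to \<open>n + 1\<close>: by the lack of memory of
  the geometric law the current sojourn ends with probability \<open>p\<close> and goes on with probability
  \<open>1 - p\<close>.\<close>

lemma (in prob_space) prob_switch_word:
  fixes G :: "nat \<Rightarrow> 'a \<Rightarrow> nat"
  assumes ind: "indep_vars (\<lambda>_. count_space UNIV) G {1..}"
    and pos: "\<And>i \<omega>. 1 \<le> G i \<omega>"
    and tail: "\<And>i a. 1 \<le> i \<Longrightarrow> \<P>(\<omega> in M. a < G i \<omega>) = (1 - p i) ^ a"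
  shows "\<P>(\<omega> in M. \<forall>i\<in>{1..n}. switches (\<lambda>i. G i \<omega>) i = b i)
    = (\<Prod>i<n. if b (Suc i) then p (Suc (switch_count b i)) else 1 - p (Suc (switch_count b i)))"
proof -
  have G: "G i \<in> M \<rightarrow>\<^sub>M count_space UNIV" if "1 \<le> i" for i
    using ind that by (auto simp: indep_vars_def2)
  have point: "\<P>(\<omega> in M. G i \<omega> = Suc a) = (1 - p i) ^ a * p i" if i: "1 \<le> i" for i a
  proof -
    have ev: "{\<omega> \<in> space M. P (G i \<omega>)} \<in> events" for P
      using measurable_sets[OF G[OF i], of "Collect P"] by (simp add: vimage_def Int_def conj_commute)
    have "\<P>(\<omega> in M. G i \<omega> = Suc a) = \<P>(\<omega> in M. a < G i \<omega>) - \<P>(\<omega> in M. Suc a < G i \<omega>)"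
      by (subst finite_measure_Diff[symmetric]) (auto intro!: ev arg_cong[where f = prob])
    then show ?thesis
      by (simp add: tail[OF i] algebra_simps)
  qed
  let ?E = "\<lambda>n. {\<omega> \<in> space M. \<forall>i\<in>{1..n}. switches (\<lambda>i. G i \<omega>) i = b i}"
  let ?k = "switch_count b"
  let ?f = "\<lambda>n. \<Prod>i<n. if b (Suc i) then p (Suc (?k i)) else 1 - p (Suc (?k i))"
  have "\<exists>r a. (\<Sum>i=1..?k n. r i) + a = n
      \<and> ?E n = {\<omega> \<in> space M. (\<forall>i\<in>{1..?k n}. G i \<omega> = r i) \<and> G (Suc (?k n)) \<omega> \<in> {a<..}}
      \<and> (\<Prod>i=1..?k n. \<P>(\<omega> in M. G i \<omega> = r i)) * (1 - p (Suc (?k n))) ^ a = ?f n"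
  proof (induction n)
    case 0
    show ?case
      by (rule exI, rule exI[of _ 0]) (use pos in \<open>auto simp: Suc_le_eq\<close>)
  next
    case (Suc n)
    then obtain r a where ra: "(\<Sum>i=1..?k n. r i) + a = n"
      and E: "?E n = {\<omega> \<in> space M. (\<forall>i\<in>{1..?k n}. G i \<omega> = r i) \<and> G (Suc (?k n)) \<omega> \<in> {a<..}}"
      and P: "(\<Prod>i=1..?k n. \<P>(\<omega> in M. G i \<omega> = r i)) * (1 - p (Suc (?k n))) ^ a = ?f n"
      by blast
    have sw: "switches (\<lambda>i. G i \<omega>) (Suc n) \<longleftrightarrow> G (Suc (?k n)) \<omega> = Suc a"
      if "\<forall>i\<in>{1..?k n}. G i \<omega> = r i" "G (Suc (?k n)) \<omega> \<in> {a<..}" for \<omega>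
    proof -
      have "(\<Sum>i=1..?k n. G i \<omega>) = (\<Sum>i=1..?k n. r i)"
        using that by (intro sum.cong) auto
      then have "switches (\<lambda>i. G i \<omega>) (Suc n) \<longleftrightarrow> (\<Sum>i=1..Suc (?k n). G i \<omega>) = Suc n"
        using that ra by (intro switches_Suc_iff pos) auto
      then show ?thesis
        using \<open>(\<Sum>i=1..?k n. G i \<omega>) = (\<Sum>i=1..?k n. r i)\<close> ra by auto
    qed
    have ES: "?E (Suc n) = {\<omega> \<in> ?E n. switches (\<lambda>i. G i \<omega>) (Suc n) = b (Suc n)}"
      by (auto simp: atLeastAtMostSuc_conv)
    show ?case
    proof (cases "b (Suc n)")
      case True
      then have k: "?k (Suc n) = Suc (?k n)"
        by (simp add: switch_count_Suc)
      let ?r = "r(Suc (?k n) := Suc a)"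
      have "?E (Suc n) = {\<omega> \<in> space M. (\<forall>i\<in>{1..Suc (?k n)}. G i \<omega> = ?r i) \<and> G (Suc (Suc (?k n))) \<omega> \<in> {0<..}}"
        unfolding ES E using sw pos True by (auto simp: atLeastAtMostSuc_conv Suc_le_eq)
      moreover have "(\<Sum>i=1..Suc (?k n). ?r i) + 0 = Suc n"
        using ra by simp
      moreover have "(\<Prod>i=1..Suc (?k n). \<P>(\<omega> in M. G i \<omega> = ?r i)) * (1 - p (Suc (Suc (?k n)))) ^ 0 = ?f (Suc n)"
        using P[symmetric] True by (simp add: point)
      ultimately show ?thesis
        unfolding k by blast
    next
      case False
      then have k: "?k (Suc n) = ?k n"
        by (simp add: switch_count_Suc)
      have "?E (Suc n) = {\<omega> \<in> space M. (\<forall>i\<in>{1..?k n}. G i \<omega> = r i) \<and> G (Suc (?k n)) \<omega> \<in> {Suc a<..}}"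
        unfolding ES E using sw False by auto
      moreover have "(\<Sum>i=1..?k n. r i) + Suc a = Suc n"
        using ra by simp
      moreover have "(\<Prod>i=1..?k n. \<P>(\<omega> in M. G i \<omega> = r i)) * (1 - p (Suc (?k n))) ^ Suc a = ?f (Suc n)"
        using P[symmetric] False by simp
      ultimately show ?thesis
        unfolding k by blast
    qed
  qed
  then obtain r a where
      E: "?E n = {\<omega> \<in> space M. (\<forall>i\<in>{1..?k n}. G i \<omega> = r i) \<and> G (Suc (?k n)) \<omega> \<in> {a<..}}"
      and P: "(\<Prod>i=1..?k n. \<P>(\<omega> in M. G i \<omega> = r i)) * (1 - p (Suc (?k n))) ^ a = ?f n"
    by blast
  show ?thesis
    unfolding E prob_indep_prefix[OF ind] using P tail[of "Suc (?k n)" a] by simp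
qed

definition coupled_chain :: "int \<Rightarrow> (nat \<Rightarrow> nat) \<Rightarrow> nat \<Rightarrow> int" where
  "coupled_chain \<sigma> g n = \<sigma> * (-1) ^ switch_count (switches g) n"

definition rate :: "real \<Rightarrow> real \<Rightarrow> nat \<Rightarrow> real" where
  "rate a b i = (if odd i then a else b)"

lemma coupled_chain_word_iff:
  assumes \<sigma>: "\<sigma> = 1 \<or> \<sigma> = -1" and y: "\<And>i. i \<le> n \<Longrightarrow> y i \<in> {-1, 1}" and y0: "y 0 = \<sigma>"
  shows "(\<forall>i\<le>n. coupled_chain \<sigma> g i = y i)
    \<longleftrightarrow> (\<forall>i\<in>{1..n}. switches g i = (y i \<noteq> y (i - 1)))"
  using y
proof (induction n)
  case 0
  then show ?case
    by (simp add: y0 coupled_chain_def)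
next
  case (Suc n)
  have IH: "(\<forall>i\<le>n. coupled_chain \<sigma> g i = y i) \<longleftrightarrow> (\<forall>i\<in>{1..n}. switches g i = (y i \<noteq> y (i - 1)))"
    using Suc by simp
  have "coupled_chain \<sigma> g (Suc n) = (if switches g (Suc n) then - coupled_chain \<sigma> g n else coupled_chain \<sigma> g n)"
    by (simp add: coupled_chain_def switch_count_Suc)
  moreover have "y n \<in> {-1, 1}" "y (Suc n) \<in> {-1, 1}"
    using Suc.prems by auto
  ultimately have "coupled_chain \<sigma> g (Suc n) = y (Suc n) \<longleftrightarrow> switches g (Suc n) = (y (Suc n) \<noteq> y n)"
    if "coupled_chain \<sigma> g n = y n"
    using that by auto
  moreover have "(\<forall>i\<le>Suc n. coupled_chain \<sigma> g i = y i) \<longleftrightarrow>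
      (\<forall>i\<le>n. coupled_chain \<sigma> g i = y i) \<and> coupled_chain \<sigma> g (Suc n) = y (Suc n)"
    by (auto simp: le_Suc_eq)
  moreover have "(\<forall>i\<in>{1..Suc n}. switches g i = (y i \<noteq> y (i - 1))) \<longleftrightarrow>
      (\<forall>i\<in>{1..n}. switches g i = (y i \<noteq> y (i - 1))) \<and> switches g (Suc n) = (y (Suc n) \<noteq> y n)"
    by (auto simp: atLeastAtMostSuc_conv)
  ultimately show ?case
    using IH by auto
qed

text \<open>The state is determined by the parity of the number of switches; this is how the alternating
  rates \<open>a\<close>, \<open>b\<close> of successive sojourns become the transition probabilities of the two states.\<close>

lemma word_parity:
  assumes \<sigma>: "\<sigma> = 1 \<or> \<sigma> = -1" and y: "\<And>i. i \<le> n \<Longrightarrow> y i \<in> {-1, 1 :: int}" and y0: "y 0 = \<sigma>"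
  shows "y n = \<sigma> * (-1) ^ switch_count (\<lambda>i. y i \<noteq> y (i - 1)) n"
  using y
proof (induction n)
  case (Suc n)
  have "y n \<in> {-1, 1}" "y (Suc n) \<in> {-1, 1}"
    using Suc.prems by auto
  moreover have "y n = \<sigma> * (-1) ^ switch_count (\<lambda>i. y i \<noteq> y (i - 1)) n"
    using Suc by simp
  ultimately show ?case
    by (auto simp: switch_count_Suc)
qed (simp add: y0)

lemma (in prob_space) prob_coupled_chain_word:
  fixes G :: "nat \<Rightarrow> 'a \<Rightarrow> nat"
  assumes ind: "indep_vars (\<lambda>_. count_space UNIV) G {1..}"
    and pos: "\<And>i \<omega>. 1 \<le> G i \<omega>"
    and tail: "\<And>i k. 1 \<le> i \<Longrightarrow> \<P>(\<omega> in M. k < G i \<omega>) = (1 - rate a b i * dx) ^ k"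
    and \<sigma>: "\<sigma> = -1 \<and> a = c0 \<and> b = c1 \<or> \<sigma> = 1 \<and> a = c1 \<and> b = c0"
    and y: "\<And>i. i \<le> n \<Longrightarrow> y i \<in> {-1, 1}"
  shows "\<P>(\<omega> in M. \<forall>i\<le>n. coupled_chain \<sigma> (\<lambda>i. G i \<omega>) i = y i)
    = of_bool (y 0 = \<sigma>) * (\<Prod>i<n. transition c0 c1 dx (y i) (y (Suc i)))"
proof (cases "y 0 = \<sigma>")
  case True
  let ?b = "\<lambda>i. y i \<noteq> y (i - 1)"
  have \<sigma>': "\<sigma> = 1 \<or> \<sigma> = -1"
    using \<sigma> by auto
  have "\<P>(\<omega> in M. \<forall>i\<le>n. coupled_chain \<sigma> (\<lambda>i. G i \<omega>) i = y i)
      = \<P>(\<omega> in M. \<forall>i\<in>{1..n}. switches (\<lambda>i. G i \<omega>) i = ?b i)"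
    by (simp only: coupled_chain_word_iff[where y = y and n = n, OF \<sigma>' y True])
  also have "\<dots> = (\<Prod>i<n. if ?b (Suc i) then rate a b (Suc (switch_count ?b i)) * dx
      else 1 - rate a b (Suc (switch_count ?b i)) * dx)"
    by (rule prob_switch_word[OF ind pos tail])
  also have "\<dots> = (\<Prod>i<n. transition c0 c1 dx (y i) (y (Suc i)))"
  proof (rule prod.cong[OF refl])
    fix i assume "i \<in> {..<n}"
    then have i: "i < n"
      by simp
    have "y i = \<sigma> * (-1) ^ switch_count ?b i"
      by (rule word_parity[where y = y, OF \<sigma>' _ True]) (use i y in auto)
    moreover have "y i \<in> {-1, 1}" "y (Suc i) \<in> {-1, 1}"
      using i y by auto
    ultimately show "(if ?b (Suc i) then rate a b (Suc (switch_count ?b i)) * dx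
        else 1 - rate a b (Suc (switch_count ?b i)) * dx) = transition c0 c1 dx (y i) (y (Suc i))"
      using \<sigma> by (cases "even (switch_count ?b i)") (auto simp: rate_def transition_def)
  qed
  finally show ?thesis
    using True by simp
next
  case False
  then have empty: "{\<omega> \<in> space M. \<forall>i\<le>n. coupled_chain \<sigma> (\<lambda>i. G i \<omega>) i = y i} = {}"
    by (auto simp: coupled_chain_def)
  show ?thesis
    unfolding empty using False by simp
qed

text \<open>An exponential variable measured in units of \<open>- ln (1 - p)\<close> and rounded up, which is geometric
  with parameter \<open>p\<close>. The maximum only matters for \<open>x \<le> 0\<close> and makes sojourns positive for every
  outcome.\<close>

definition sojourn :: "real \<Rightarrow> real \<Rightarrow> nat" where
  "sojourn p x = max 1 (nat \<lceil>x / - ln (1 - p)\<rceil>)"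

lemma sojourn_measurable [measurable]: "sojourn p \<in> borel \<rightarrow>\<^sub>M count_space UNIV"
  unfolding sojourn_def[abs_def] by measurable

lemma (in prob_space) prob_sojourn_tail:
  assumes X: "distributed M lborel X (exponential_density 1)" and p: "0 < p" "p < 1"
  shows "\<P>(\<omega> in M. k < sojourn p (X \<omega>)) = (1 - p) ^ k"
proof (cases "k = 0")
  case True
  moreover have "0 < sojourn p x" for x
    by (simp add: sojourn_def less_max_iff_disj)
  ultimately show ?thesis
    by (simp add: prob_space)
next
  case False
  define \<mu> where "\<mu> = - ln (1 - p)"
  have \<mu>: "0 < \<mu>"
    using p by (simp add: \<mu>_def)
  have "k < sojourn p x \<longleftrightarrow> real k * \<mu> < x" for x
  proof -
    have "k < sojourn p x \<longleftrightarrow> int k < \<lceil>x / \<mu>\<rceil>"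
      using False by (auto simp: sojourn_def \<mu>_def[symmetric])
    also have "\<dots> \<longleftrightarrow> real k < x / \<mu>"
      by (simp add: less_ceiling_iff)
    finally show ?thesis
      using \<mu> by (simp add: field_simps)
  qed
  then have "\<P>(\<omega> in M. k < sojourn p (X \<omega>)) = exp (- (real k * \<mu>) * 1)"
    using exponential_distributedD_gt[OF X, of "real k * \<mu>"] \<mu> by simp
  also have "\<dots> = exp (ln (1 - p)) ^ k"
    by (simp add: \<mu>_def flip: exp_of_nat_mult)
  finally show ?thesis
    using p by simp
qed

lemma sojourn_close:
  assumes "0 < x" "0 < p" "p < 1"
  shows "\<bar>real (sojourn p x) - x / - ln (1 - p)\<bar> \<le> 1"
proof -
  define z where "z = x / - ln (1 - p)"
  have "0 < z"
    unfolding z_def using assms by (intro divide_pos_pos) auto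
  then have "real (max 1 (nat \<lceil>z\<rceil>)) = of_int \<lceil>z\<rceil>"
    by linarith
  then show ?thesis
    unfolding sojourn_def z_def[symmetric] by linarith
qed

section \<open>The Markov chain read off exponential clocks\<close>

lemma measurable_sum_count_space:
  fixes f :: "'i \<Rightarrow> 'a \<Rightarrow> nat"
  assumes "finite I" "\<And>i. i \<in> I \<Longrightarrow> f i \<in> M \<rightarrow>\<^sub>M count_space UNIV"
  shows "(\<lambda>x. \<Sum>i\<in>I. f i x) \<in> M \<rightarrow>\<^sub>M count_space UNIV"
  using assms
proof (induction I)
  case (insert i I)
  have [measurable]: "f i \<in> M \<rightarrow>\<^sub>M count_space UNIV" "(\<lambda>x. \<Sum>i\<in>I. f i x) \<in> M \<rightarrow>\<^sub>M count_space UNIV"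
    using insert by auto
  show ?case
    using insert.hyps by simp
qed simp

lemma switch_count_measurable:
  assumes B: "\<And>i. 1 \<le> i \<Longrightarrow> Measurable.pred M (\<lambda>\<omega>. B \<omega> i)"
  shows "(\<lambda>\<omega>. switch_count (B \<omega>) n) \<in> M \<rightarrow>\<^sub>M count_space UNIV"
proof -
  have eq: "switch_count (B \<omega>) n = (\<Sum>i\<in>{1..n}. of_bool (B \<omega> i))" for \<omega>
    by (induction n) (simp_all add: switch_count_Suc)
  have "(\<lambda>\<omega>. of_bool (B \<omega> i) :: nat) \<in> M \<rightarrow>\<^sub>M count_space UNIV" if "i \<in> {1..n}" for i
    using B[of i] that by (intro measurable_compose[where f = "\<lambda>\<omega>. B \<omega> i" and g = of_bool and N = "count_space UNIV"]) auto
  then show ?thesis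
    unfolding eq by (intro measurable_sum_count_space) auto
qed

lemma switches_measurable:
  assumes G: "\<And>i. 1 \<le> i \<Longrightarrow> G i \<in> M \<rightarrow>\<^sub>M count_space UNIV"
  shows "Measurable.pred M (\<lambda>\<omega>. switches (\<lambda>i. G i \<omega>) n)"
proof -
  have [measurable]: "(\<lambda>\<omega>. \<Sum>i=1..k. G i \<omega>) \<in> M \<rightarrow>\<^sub>M count_space UNIV" for k
    using G by (intro measurable_sum_count_space) auto
  show ?thesis
    unfolding switches_def by measurable
qed

lemma coupled_chain_measurable:
  assumes G: "\<And>i. 1 \<le> i \<Longrightarrow> G i \<in> M \<rightarrow>\<^sub>M count_space UNIV" and \<sigma>: "\<sigma> = 1 \<or> \<sigma> = -1"
  shows "(\<lambda>\<omega>. coupled_chain \<sigma> (\<lambda>i. G i \<omega>) n) \<in> M \<rightarrow>\<^sub>M count_space {-1, 1}"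
proof -
  have "(\<lambda>\<omega>. switch_count (switches (\<lambda>i. G i \<omega>)) n) \<in> M \<rightarrow>\<^sub>M count_space UNIV"
    by (intro switch_count_measurable switches_measurable G)
  then show ?thesis
    unfolding coupled_chain_def
    by (rule measurable_compose[where g = "\<lambda>k. \<sigma> * (-1) ^ k"])
       (use \<sigma> in \<open>auto simp: minus_one_power_iff split: if_splits\<close>)
qed

definition sojourns :: "real \<Rightarrow> real \<Rightarrow> real \<Rightarrow> (nat \<Rightarrow> real) \<Rightarrow> nat \<Rightarrow> nat" where
  "sojourns a b dx x i = sojourn (rate a b i * dx) (x i)"

lemma sojourns_pos: "1 \<le> sojourns a b dx x i"
  by (simp add: sojourns_def sojourn_def)

lemma iid_exponential_sojourns:
  assumes e: "iid_exponential N e" and ab: "0 < a" "0 < b" and dx: "0 < dx" "a * dx < 1" "b * dx < 1"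
  shows "prob_space.indep_vars N (\<lambda>_. count_space UNIV) (\<lambda>i \<omega>. sojourns a b dx (\<lambda>j. e j \<omega>) i) {1..}"
    and "1 \<le> i \<Longrightarrow> \<P>(\<omega> in N. k < sojourns a b dx (\<lambda>j. e j \<omega>) i) = (1 - rate a b i * dx) ^ k"
    and "1 \<le> i \<Longrightarrow> (\<lambda>\<omega>. sojourns a b dx (\<lambda>j. e j \<omega>) i) \<in> N \<rightarrow>\<^sub>M count_space UNIV"
proof -
  interpret prob_space N
    using e by (simp add: iid_exponential_def)
  show ind: "indep_vars (\<lambda>_. count_space UNIV) (\<lambda>i \<omega>. sojourns a b dx (\<lambda>j. e j \<omega>) i) {1..}"
    unfolding sojourns_def
    by (rule indep_vars_compose2[where M' = "\<lambda>_. borel"]) (use e in \<open>auto simp: iid_exponential_def\<close>)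
  show "1 \<le> i \<Longrightarrow> \<P>(\<omega> in N. k < sojourns a b dx (\<lambda>j. e j \<omega>) i) = (1 - rate a b i * dx) ^ k"
    unfolding sojourns_def using e ab dx
    by (intro prob_sojourn_tail) (auto simp: iid_exponential_def rate_def)
  show "1 \<le> i \<Longrightarrow> (\<lambda>\<omega>. sojourns a b dx (\<lambda>j. e j \<omega>) i) \<in> N \<rightarrow>\<^sub>M count_space UNIV"
    using ind by (auto simp: indep_vars_def2)
qed

text \<open>The path of the walk is a measurable function of the whole sequence of states, and the given
  chain and the coupled chain have the same law as sequences.\<close>

lemma path_law_coupled:
  assumes e: "iid_exponential N e" and ab: "0 < a" "0 < b" and dx: "0 < dx" "a * dx < 1" "b * dx < 1"
    and \<sigma>: "\<sigma> = -1 \<and> a = c0 \<and> b = c1 \<or> \<sigma> = 1 \<and> a = c1 \<and> b = c0"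
    and mc: "markov_chain M {-1, 1} (transition c0 c1 dx) Y" and start: "AE \<omega> in M. Y 0 \<omega> = \<sigma>"
  shows "path_law M (interpolated_walk dx dx Y)
    = path_law N (interpolated_walk dx dx (\<lambda>i \<omega>. coupled_chain \<sigma> (sojourns a b dx (\<lambda>j. e j \<omega>)) i))"
    (is "_ = path_law N (interpolated_walk dx dx ?C)")
proof -
  define Q where "Q = PiM (UNIV :: nat set) (\<lambda>_. count_space {-1, 1 :: int})"
  define W where "W y = path_of (\<lambda>s. interpolated_walk dx dx (\<lambda>i y. y i) s y)" for y :: "nat \<Rightarrow> int"
  interpret N: prob_space N
    using e by (simp add: iid_exponential_def)
  have Y: "Y n \<in> M \<rightarrow>\<^sub>M count_space {-1, 1}" for n
    using mc by (simp add: markov_chain_def)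
  have C: "?C n \<in> N \<rightarrow>\<^sub>M count_space {-1, 1}" for n
    using coupled_chain_measurable[OF iid_exponential_sojourns(3)[OF e ab dx], where \<sigma> = \<sigma> and n = n] \<sigma> by auto
  have W: "W \<in> Q \<rightarrow>\<^sub>M borel"
    unfolding W_def[abs_def] by (rule interpolated_walk_path_measurable[OF dx(1)]) (simp add: Q_def)
  have law: "path_law L (interpolated_walk dx dx V) = distr (distr L Q (\<lambda>\<omega> n. V n \<omega>)) borel W"
    if V: "\<And>n. V n \<in> L \<rightarrow>\<^sub>M count_space {-1, 1}" for L :: "'c measure" and V
  proof -
    have "(\<lambda>\<omega> n. V n \<omega>) \<in> L \<rightarrow>\<^sub>M Q"
      unfolding Q_def using measurable_space[OF V] by (intro measurable_PiM_single') (auto intro: V)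
    then show ?thesis
      by (simp add: distr_distr[OF W] path_law_def comp_def W_def interpolated_walk_def
          normalized_walk_def persistent_walk_def)
  qed
  have "distr M Q (\<lambda>\<omega> n. Y n \<omega>) = distr N Q (\<lambda>\<omega> n. ?C n \<omega>)"
    unfolding Q_def
  proof (rule distr_sequence_eqI[OF _ N.prob_space_axioms _ Y C])
    show "prob_space M"
      using mc by (simp add: markov_chain_def)
    fix n and w :: "nat \<Rightarrow> int"
    assume w: "\<And>i. i \<le> n \<Longrightarrow> w i \<in> {-1, 1}"
    have "\<P>(\<omega> in N. \<forall>i\<le>n. ?C i \<omega> = w i)
        = of_bool (w 0 = \<sigma>) * (\<Prod>i<n. transition c0 c1 dx (w i) (w (Suc i)))"
      by (rule N.prob_coupled_chain_word[OF iid_exponential_sojourns(1)[OF e ab dx] sojourns_pos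
            iid_exponential_sojourns(2)[OF e ab dx] \<sigma> w])
    then show "\<P>(\<omega> in M. \<forall>i\<le>n. Y i \<omega> = w i) = \<P>(\<omega> in N. \<forall>i\<le>n. ?C i \<omega> = w i)"
      by (simp add: markov_chain_prefix[where y = w, OF mc start w])
  qed simp
  then show ?thesis
    by (simp add: law[OF Y] law[OF C])
qed

section \<open>The telegraph process as a random path\<close>

definition arrival :: "real \<Rightarrow> real \<Rightarrow> (nat \<Rightarrow> real) \<Rightarrow> nat \<Rightarrow> real" where
  "arrival a b x k = (\<Sum>i=1..k. jump_scale a b i * x i)"

lemma infsum_of_bool_finite:
  assumes "finite {k \<in> A. P k}"
  shows "(\<Sum>\<^sub>\<infinity>k\<in>A. of_bool (P k) :: nat) = card {k \<in> A. P k}"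
proof -
  have "(\<Sum>\<^sub>\<infinity>k\<in>A. of_bool (P k) :: nat) = (\<Sum>\<^sub>\<infinity>k\<in>{k \<in> A. P k}. 1)"
    by (rule infsum_cong_neutral) auto
  then show ?thesis
    using assms by simp
qed

text \<open>In the discrete topology of the natural numbers a sum with infinitely many nonzero terms does
  not converge.\<close>

lemma infsum_of_bool_infinite:
  assumes inf: "infinite {k \<in> A. P k}"
  shows "(\<Sum>\<^sub>\<infinity>k\<in>A. of_bool (P k) :: nat) = 0"
  using inf by (intro infsum_not_exists) (simp add: summable_on_discrete_iff)

text \<open>A property that fails from some index on is counted by a finite sum; on the remaining outcomes
  the infinite sum has the default value 0. Both cases are countable combinations of events.\<close>

lemma infsum_of_bool_measurable:
  assumes [measurable]: "\<And>k. 1 \<le> k \<Longrightarrow> Measurable.pred M (P k)"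
  shows "(\<lambda>x. \<Sum>\<^sub>\<infinity>k\<in>{1::nat..}. of_bool (P k x) :: nat) \<in> M \<rightarrow>\<^sub>M count_space UNIV"
proof -
  let ?P = "\<lambda>k x. 1 \<le> k \<and> P k x"
  have m [measurable]: "Measurable.pred M (?P k)" for k
    by (cases "1 \<le> k") auto
  have [measurable]: "(\<lambda>x. \<Sum>k<m. of_bool (?P k x) :: nat) \<in> M \<rightarrow>\<^sub>M count_space UNIV" for m
    by (intro measurable_sum_count_space measurable_compose[OF m, where g = of_bool]) auto
  have eq: "(\<Sum>\<^sub>\<infinity>k\<in>{1::nat..}. of_bool (P k x) :: nat) = c \<longleftrightarrow>
      (\<exists>m. (\<forall>k\<ge>m. \<not> ?P k x) \<and> (\<Sum>k<m. of_bool (?P k x)) = c) \<or> (\<forall>m. \<exists>k\<ge>m. ?P k x) \<and> c = 0" for c x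
  proof (cases "finite {k \<in> {1..}. P k x}")
    case True
    then obtain m0 where m0: "\<And>k. ?P k x \<Longrightarrow> k < m0"
      by (auto simp: finite_nat_set_iff_bounded)
    have card: "(\<Sum>k<m. of_bool (?P k x) :: nat) = card {k \<in> {1..}. P k x}"
      if "\<forall>k\<ge>m. \<not> ?P k x" for m
    proof -
      have "{..<m} \<inter> {k. ?P k x} = {k \<in> {1..}. P k x}"
        using that by (auto simp: not_le[symmetric])
      then show ?thesis
        by simp
    qed
    have none: "\<forall>k\<ge>m0. \<not> ?P k x"
      using m0 leD by blast
    then have "(\<exists>m. (\<forall>k\<ge>m. \<not> ?P k x) \<and> (\<Sum>k<m. of_bool (?P k x)) = c)
        \<longleftrightarrow> card {k \<in> {1..}. P k x} = c" (is "?L \<longleftrightarrow> _")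
    proof (intro iffI)
      assume ?L
      then obtain m where "\<forall>k\<ge>m. \<not> ?P k x" "(\<Sum>k<m. of_bool (?P k x)) = c"
        by (elim exE conjE)
      then show "card {k \<in> {1..}. P k x} = c"
        using card[of m] by simp
    next
      assume "card {k \<in> {1..}. P k x} = c"
      then show ?L
        using none card[OF none] by (intro exI[of _ m0] conjI) simp_all
    qed
    moreover have "\<not> (\<forall>m. \<exists>k\<ge>m. ?P k x)"
      using none by (auto intro!: exI[of _ m0])
    ultimately show ?thesis
      unfolding infsum_of_bool_finite[OF True] by (simp only: simp_thms)
  next
    case False
    then have "\<exists>k\<ge>m. ?P k x" for m
      by (auto simp: infinite_nat_iff_unbounded_le)
    then show ?thesis
      unfolding infsum_of_bool_infinite[OF False] by blast
  qed
  have "{x \<in> space M. (\<Sum>\<^sub>\<infinity>k\<in>{1::nat..}. of_bool (P k x) :: nat) = c} \<in> sets M" for c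
    unfolding eq by measurable
  then show ?thesis
    by (subst measurable_count_space_eq2_countable) (auto simp: vimage_def Int_def conj_commute)
qed

lemma counting_process_measurable:
  assumes e: "\<And>i. 1 \<le> i \<Longrightarrow> e i \<in> borel_measurable N" and t: "t \<in> borel_measurable N"
  shows "(\<lambda>\<omega>. counting_process a b e (t \<omega>) \<omega>) \<in> N \<rightarrow>\<^sub>M count_space UNIV"
proof -
  have [measurable]: "(\<lambda>\<omega>. \<Sum>i=1..k. jump_scale a b i * e i \<omega>) \<in> borel_measurable N" for k
    using e by (intro borel_measurable_sum) auto
  note t [measurable]
  show ?thesis
    unfolding counting_process_def by (rule infsum_of_bool_measurable) measurable
qed

definition telegraph_sign :: "real \<Rightarrow> real \<Rightarrow> (nat \<Rightarrow> 'b \<Rightarrow> real) \<Rightarrow> real \<Rightarrow> 'b \<Rightarrow> real" where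
  "telegraph_sign a b e u \<omega> = (-1) ^ counting_process a b e u \<omega>"

lemma telegraph_sign_measurable:
  assumes e: "\<And>i. 1 \<le> i \<Longrightarrow> e i \<in> borel_measurable N" and t: "t \<in> borel_measurable N"
  shows "(\<lambda>\<omega>. telegraph_sign a b e (t \<omega>) \<omega>) \<in> borel_measurable N"
proof -
  have "(\<lambda>\<omega>. counting_process a b e (t \<omega>) \<omega>) \<in> N \<rightarrow>\<^sub>M count_space UNIV"
    by (rule counting_process_measurable[where N = N and t = t and e = e, OF e t])
  then have "(\<lambda>\<omega>. (-1 :: real) ^ counting_process a b e (t \<omega>) \<omega>) \<in> borel_measurable N"
    by (rule measurable_compose) simp
  then show ?thesis
    by (simp only: telegraph_sign_def)
qed

lemma abs_telegraph_sign [simp]: "\<bar>telegraph_sign a b e u \<omega>\<bar> = 1"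
  unfolding telegraph_sign_def power_abs by simp

lemma telegraph_sign_borel [measurable]: "(\<lambda>u. telegraph_sign a b e u \<omega>) \<in> borel_measurable borel"
proof -
  have "(\<lambda>u. telegraph_sign a b (\<lambda>i u. e i \<omega>) u u) \<in> borel_measurable borel"
    by (rule telegraph_sign_measurable) simp_all
  then show ?thesis
    by (simp only: telegraph_sign_def counting_process_def)
qed

lemma telegraph_process_eq: "telegraph_process a b e t \<omega> = (LBINT u:{0..t}. telegraph_sign a b e u \<omega>)"
  by (simp add: telegraph_process_def telegraph_sign_def)

lemma unit_speed_telegraph:
  assumes "\<bar>\<sigma>\<bar> = 1"
  shows "unit_speed (\<lambda>t. \<sigma> * telegraph_process a b e t \<omega>)"
proof -
  have "unit_speed (\<lambda>t. 0 + (LBINT u:{0..t}. \<sigma> * telegraph_sign a b e u \<omega>))"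
    by (rule unit_speed_integral) (use assms in \<open>auto simp: abs_mult\<close>)
  then show ?thesis
    by (simp add: telegraph_process_eq)
qed

text \<open>By Fubini, since the sign is jointly measurable in time and outcome. Joint measurability is the
  measurability of the counting process at a random time, applied on the product space.\<close>

lemma telegraph_process_measurable:
  assumes e: "\<And>i. 1 \<le> i \<Longrightarrow> e i \<in> borel_measurable N"
  shows "telegraph_process a b e t \<in> borel_measurable N"
proof -
  have "(\<lambda>p. telegraph_sign a b (\<lambda>i p. e i (fst p)) (snd p) p) \<in> borel_measurable (N \<Otimes>\<^sub>M lborel)"
  proof (rule telegraph_sign_measurable)
    show "(\<lambda>p. e i (fst p)) \<in> borel_measurable (N \<Otimes>\<^sub>M lborel)" if "1 \<le> i" for i
      by (rule measurable_compose[OF measurable_fst e[OF that]])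
  qed simp
  then have [measurable]: "(\<lambda>p. telegraph_sign a b e (snd p) (fst p)) \<in> borel_measurable (N \<Otimes>\<^sub>M lborel)"
    by (simp add: telegraph_sign_def counting_process_def)
  show ?thesis
    unfolding telegraph_process_eq[abs_def] set_lebesgue_integral_def
    by (rule lborel.borel_measurable_lebesgue_integral) (simp add: split_beta')
qed

lemma iid_exponential_borel:
  assumes "iid_exponential N e" "1 \<le> i"
  shows "e i \<in> borel_measurable N"
proof -
  have "distributed N lborel (e i) (exponential_density 1)"
    using assms by (simp add: iid_exponential_def)
  from distributed_measurable[OF this] show ?thesis
    by simp
qed

lemma continuous_process_telegraph:
  assumes e: "iid_exponential N e" and \<sigma>: "\<bar>\<sigma>\<bar> = 1"
  shows "continuous_process N (\<lambda>t \<omega>. \<sigma> * telegraph_process a b e t \<omega>)"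
  unfolding continuous_process_def
proof (intro conjI ballI)
  show "prob_space N"
    using e by (simp add: iid_exponential_def)
  show "continuous_on {0..} (\<lambda>t. \<sigma> * telegraph_process a b e t \<omega>)" for \<omega>
    by (rule unit_speed_continuous[OF unit_speed_telegraph[OF \<sigma>]])
  show "(\<lambda>\<omega>. path_of (\<lambda>t. \<sigma> * telegraph_process a b e t \<omega>)) \<in> N \<rightarrow>\<^sub>M borel"
  proof (rule unit_speed_process_measurable)
    have "telegraph_process a b e t \<in> borel_measurable N" for t
      by (rule telegraph_process_measurable[OF iid_exponential_borel[OF e]])
    then show "(\<lambda>\<omega>. \<sigma> * telegraph_process a b e t \<omega>) \<in> borel_measurable N" for t
      by simp
  qed (rule unit_speed_telegraph[OF \<sigma>])
qed

section \<open>Convergence of the switching times\<close>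

text \<open>The derivative of \<open>- ln (1 - r h)\<close> at 0 is \<open>r\<close>.\<close>

lemma divide_minus_ln_tendsto:
  fixes d :: "nat \<Rightarrow> real"
  assumes d: "d \<longlonglongrightarrow> 0" "\<And>n. 0 < d n" and r: "0 < r"
  shows "(\<lambda>n. d n / - ln (1 - r * d n)) \<longlonglongrightarrow> 1 / r"
proof -
  have "((\<lambda>h. - ln (1 - r * h)) has_real_derivative r) (at 0)"
    by (auto intro!: derivative_eq_intros)
  then have "((\<lambda>h. - ln (1 - r * h) / h) \<longlongrightarrow> r) (at 0)"
    by (simp add: DERIV_def)
  moreover have "filterlim d (at 0) sequentially"
    using d(1)
  proof (rule filterlim_atI)
    show "\<forall>\<^sub>F n in sequentially. d n \<noteq> 0"
      by (rule always_eventually) (metis d(2) less_irrefl)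
  qed
  ultimately have "(\<lambda>n. - ln (1 - r * d n) / d n) \<longlonglongrightarrow> r"
    by (rule filterlim_compose)
  then have "(\<lambda>n. inverse (- ln (1 - r * d n) / d n)) \<longlonglongrightarrow> inverse r"
    using r by (intro tendsto_inverse) auto
  then show ?thesis
    by (simp add: inverse_eq_divide)
qed

lemma scaled_sojourn_tendsto:
  fixes d :: "nat \<Rightarrow> real"
  assumes d: "d \<longlonglongrightarrow> 0" "\<And>n. 0 < d n" and r: "0 < r" "\<And>n. r * d n < 1" and x: "0 < x"
  shows "(\<lambda>n. d n * real (sojourn (r * d n) x)) \<longlonglongrightarrow> x / r"
proof -
  have "(\<lambda>n. x * (d n / - ln (1 - r * d n))) \<longlonglongrightarrow> x * (1 / r)"
    by (intro tendsto_mult tendsto_const divide_minus_ln_tendsto d r)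
  moreover have "(\<lambda>n. d n * real (sojourn (r * d n) x) - x * (d n / - ln (1 - r * d n))) \<longlonglongrightarrow> 0"
  proof (rule Lim_null_comparison[OF always_eventually d(1)], rule allI)
    fix n
    define \<mu> where "\<mu> = - ln (1 - r * d n)"
    have "d n * real (sojourn (r * d n) x) - x * (d n / \<mu>)
        = d n * (real (sojourn (r * d n) x) - x / \<mu>)"
      by (simp add: right_diff_distrib mult.commute)
    also have "\<bar>\<dots>\<bar> \<le> d n * 1"
      unfolding abs_mult \<mu>_def using d(2)[of n] sojourn_close[OF x, of "r * d n"] r by (intro mult_mono) auto
    finally show "norm (d n * real (sojourn (r * d n) x) - x * (d n / - ln (1 - r * d n))) \<le> d n"
      by (simp only: \<mu>_def real_norm_def mult_1_right)
  qed
  ultimately show ?thesis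
    using tendsto_add by fastforce
qed

text \<open>For positive \<open>a\<close> and \<open>b\<close>, the outcomes for which the jump times increase strictly to infinity.\<close>

definition regular_clock :: "real \<Rightarrow> real \<Rightarrow> (nat \<Rightarrow> real) \<Rightarrow> bool" where
  "regular_clock a b x \<longleftrightarrow> (\<forall>i\<ge>1. 0 < x i) \<and> (\<forall>u. \<exists>m. u < arrival a b x m)"

lemma jump_scale_rate: "jump_scale a b i = 1 / rate a b i"
  by (simp add: jump_scale_def rate_def)

lemma rate_pos: "0 < a \<Longrightarrow> 0 < b \<Longrightarrow> 0 < rate a b i"
  by (simp add: rate_def)

lemma arrival_mono:
  assumes "regular_clock a b x" "0 < a" "0 < b" "j \<le> k"
  shows "arrival a b x j \<le> arrival a b x k"
  unfolding arrival_def
  by (rule sum_mono2) (use assms in \<open>auto simp: regular_clock_def jump_scale_rate rate_pos less_imp_le\<close>)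

lemma scaled_switch_time_tendsto:
  fixes d :: "nat \<Rightarrow> real"
  assumes d: "d \<longlonglongrightarrow> 0" "\<And>n. 0 < d n" and ab: "0 < a" "0 < b"
    and small: "\<And>n. a * d n < 1" "\<And>n. b * d n < 1" and x: "regular_clock a b x"
  shows "(\<lambda>n. d n * real (\<Sum>i=1..k. sojourns a b (d n) x i)) \<longlonglongrightarrow> arrival a b x k"
proof -
  have "(\<lambda>n. \<Sum>i=1..k. d n * real (sojourn (rate a b i * d n) (x i))) \<longlonglongrightarrow> (\<Sum>i=1..k. x i / rate a b i)"
    by (intro tendsto_sum scaled_sojourn_tendsto d rate_pos ab)
       (use small x in \<open>auto simp: rate_def regular_clock_def\<close>)
  then show ?thesis
    by (simp add: arrival_def jump_scale_rate sojourns_def sum_distrib_left)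
qed

text \<open>Each single arrival is eventually on the correct side of \<open>u\<close>, as \<open>u\<close> is not one of the limits.
  Only finitely many arrivals have to be watched: once arrival \<open>m\<close> lies beyond \<open>u\<close>, all later ones do
  by monotonicity.\<close>

lemma eventually_same_arrivals:
  fixes s :: "nat \<Rightarrow> nat \<Rightarrow> real" and S :: "nat \<Rightarrow> real"
  assumes lim: "\<And>k. (\<lambda>n. s n k) \<longlonglongrightarrow> S k" and mono: "\<And>n j k. j \<le> k \<Longrightarrow> s n j \<le> s n k"
    and m: "u < S m" and u: "\<And>k. 1 \<le> k \<Longrightarrow> S k \<noteq> u"
  shows "\<forall>\<^sub>F n in sequentially. {k \<in> {1..}. s n k \<le> u} = {k \<in> {1..}. S k \<le> u}"
proof -
  have S_mono: "S j \<le> S k" if "j \<le> k" for j k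
    by (rule LIMSEQ_le[OF lim lim]) (auto intro: mono that)
  have "\<forall>\<^sub>F n in sequentially. s n k \<le> u \<longleftrightarrow> S k \<le> u" if "k \<in> {1..m}" for k
  proof (cases "S k < u")
    case True
    show ?thesis
      using order_tendstoD(2)[OF lim True] by eventually_elim (use True in auto)
  next
    case False
    then have "u < S k"
      using u[of k] that by auto
    show ?thesis
      using order_tendstoD(1)[OF lim \<open>u < S k\<close>] by eventually_elim (use \<open>u < S k\<close> in auto)
  qed
  then have "\<forall>\<^sub>F n in sequentially. \<forall>k\<in>{1..m}. s n k \<le> u \<longleftrightarrow> S k \<le> u"
    by (intro eventually_ball_finite) auto
  moreover have "\<forall>\<^sub>F n in sequentially. u < s n m"
    by (rule order_tendstoD(1)[OF lim m])
  ultimately show ?thesis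
  proof eventually_elim
    case (elim n)
    have "s n k \<le> u \<longleftrightarrow> S k \<le> u" if "1 \<le> k" for k
    proof (cases "k \<le> m")
      case True
      then show ?thesis using elim(1) that by auto
    next
      case False
      then show ?thesis
        using mono[of m k n] S_mono[of m k] elim(2) m by auto
    qed
    then show ?case by auto
  qed
qed

text \<open>Distinct sojourn numbers end at distinct times, so counting switching times is counting
  completed sojourns.\<close>

lemma switch_count_eq_card:
  assumes g: "\<And>i. 1 \<le> g i"
  shows "switch_count (switches g) n = card {k \<in> {1..}. (\<Sum>i=1..k. g i) \<le> n}"
proof -
  define \<tau> where "\<tau> k = (\<Sum>i=1..k. g i)" for k
  have "strict_mono \<tau>"
    unfolding strict_mono_Suc_iff \<tau>_def using g by (auto simp: Suc_le_eq)
  then have inj: "inj_on \<tau> A" for A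
    by (rule strict_mono_imp_inj_on)
  have "1 \<le> \<tau> k" if "1 \<le> k" for k
    using g[of k] that member_le_sum[of k "{1..k}" g] by (auto simp: \<tau>_def)
  then have image: "{i \<in> {1..n}. switches g i} = \<tau> ` {k \<in> {1..}. \<tau> k \<le> n}"
    by (auto simp: switches_def \<tau>_def)
  show ?thesis
    unfolding switch_count_def image card_image[OF inj] by (simp only: \<tau>_def)
qed

lemma finite_arrivals:
  assumes x: "regular_clock a b x" and ab: "0 < a" "0 < b"
  shows "finite {k \<in> {1..}. arrival a b x k \<le> u}"
proof -
  obtain m where "u < arrival a b x m"
    using x by (auto simp: regular_clock_def)
  then have "k \<le> m" if "arrival a b x k \<le> u" for k
    using arrival_mono[OF x ab, of m k] that by linarith
  then have "{k \<in> {1..}. arrival a b x k \<le> u} \<subseteq> {..m}"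
    by blast
  then show ?thesis
    by (rule finite_subset) simp
qed

lemma counting_process_eq_card:
  assumes "regular_clock a b (\<lambda>i. e i \<omega>)" "0 < a" "0 < b"
  shows "counting_process a b e u \<omega> = card {k \<in> {1..}. arrival a b (\<lambda>i. e i \<omega>) k \<le> u}"
  using infsum_of_bool_finite[OF finite_arrivals[OF assms, of u]]
  by (simp add: counting_process_def arrival_def)

text \<open>The velocity at \<open>u\<close> counts the switches up to step \<open>\<lfloor>u / dx\<rfloor> + 1\<close>, that is, the switching times
  that are at most \<open>u\<close> after scaling by \<open>dx\<close> and moving back by \<open>dx\<close>.\<close>

lemma velocity_coupled_tendsto:
  fixes d :: "nat \<Rightarrow> real"
  assumes d: "d \<longlonglongrightarrow> 0" "\<And>n. 0 < d n" and ab: "0 < a" "0 < b"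
    and small: "\<And>n. a * d n < 1" "\<And>n. b * d n < 1" and x: "regular_clock a b (\<lambda>i. e i \<omega>)"
    and u: "0 \<le> u" "\<And>k. 1 \<le> k \<Longrightarrow> arrival a b (\<lambda>i. e i \<omega>) k \<noteq> u"
  shows "(\<lambda>n. velocity (d n) (coupled_chain \<sigma> (sojourns a b (d n) (\<lambda>i. e i \<omega>))) u)
    \<longlonglongrightarrow> real_of_int \<sigma> * telegraph_sign a b e u \<omega>"
proof (rule tendsto_eventually)
  let ?g = "\<lambda>n. sojourns a b (d n) (\<lambda>i. e i \<omega>)"
  let ?s = "\<lambda>n k. d n * real (\<Sum>i=1..k. ?g n i) - d n"
  obtain m where m: "u < arrival a b (\<lambda>i. e i \<omega>) m"
    using x by (auto simp: regular_clock_def)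
  have "\<forall>\<^sub>F n in sequentially. {k \<in> {1..}. ?s n k \<le> u} = {k \<in> {1..}. arrival a b (\<lambda>i. e i \<omega>) k \<le> u}"
  proof (rule eventually_same_arrivals[where u = u and S = "arrival a b (\<lambda>i. e i \<omega>)", OF _ _ m u(2)])
    show "(\<lambda>n. ?s n k) \<longlonglongrightarrow> arrival a b (\<lambda>i. e i \<omega>) k" for k
      using tendsto_diff[OF scaled_switch_time_tendsto[OF d ab small x] d(1)] by simp
    show "?s n j \<le> ?s n k" if "j \<le> k" for n j k
      using d(2)[of n] that by (auto intro!: mult_left_mono sum_mono2 simp flip: of_nat_sum)
  qed
  then show "\<forall>\<^sub>F n in sequentially. velocity (d n) (coupled_chain \<sigma> (?g n)) u
      = real_of_int \<sigma> * telegraph_sign a b e u \<omega>"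
  proof eventually_elim
    case (elim n)
    have "t \<le> nat \<lfloor>u / d n\<rfloor> + 1 \<longleftrightarrow> d n * real t - d n \<le> u" for t :: nat
    proof -
      have "0 \<le> u / d n"
        using u(1) d(2)[of n] by simp
      then have "t \<le> nat \<lfloor>u / d n\<rfloor> + 1 \<longleftrightarrow> int t - 1 \<le> \<lfloor>u / d n\<rfloor>"
        by linarith
      also have "\<dots> \<longleftrightarrow> real t - 1 \<le> u / d n"
        by (simp add: le_floor_iff)
      also have "\<dots> \<longleftrightarrow> d n * real t - d n \<le> u"
        using d(2)[of n] by (simp add: field_simps)
      finally show ?thesis .
    qed
    then have "switch_count (switches (?g n)) (nat \<lfloor>u / d n\<rfloor> + 1) = card {k \<in> {1..}. ?s n k \<le> u}"
      unfolding switch_count_eq_card[of "?g n", OF sojourns_pos] by simp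
    then show ?case
      by (simp only: velocity_def coupled_chain_def telegraph_sign_def elim
          counting_process_eq_card[where e = e and \<omega> = \<omega>, OF x ab]) simp
  qed
qed

section \<open>Convergence in distribution to the telegraph process\<close>

text \<open>Both paths are integrals of velocities bounded by 1, so on \<open>[0, T]\<close> they differ by at most \<open>dx\<close>
  plus the \<open>L\<^sup>1\<close> distance of the velocities, which tends to 0 by dominated convergence.\<close>

lemma coupled_path_tendsto:
  fixes d :: "nat \<Rightarrow> real" and \<sigma> :: int
  assumes d: "d \<longlonglongrightarrow> 0" "\<And>n. 0 < d n" and ab: "0 < a" "0 < b"
    and small: "\<And>n. a * d n < 1" "\<And>n. b * d n < 1" and x: "regular_clock a b (\<lambda>i. e i \<omega>)"
    and \<sigma>: "\<bar>\<sigma>\<bar> = 1"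
  shows "(\<lambda>n. path_of (\<lambda>s. interpolated_walk (d n) (d n)
        (\<lambda>i \<omega>. coupled_chain \<sigma> (sojourns a b (d n) (\<lambda>j. e j \<omega>)) i) s \<omega>))
    \<longlonglongrightarrow> path_of (\<lambda>s. real_of_int \<sigma> * telegraph_process a b e s \<omega>)"
proof -
  let ?C = "\<lambda>n. coupled_chain \<sigma> (sojourns a b (d n) (\<lambda>j. e j \<omega>))"
  let ?X = "\<lambda>n s. interpolated_walk (d n) (d n)
    (\<lambda>i \<omega>. coupled_chain \<sigma> (sojourns a b (d n) (\<lambda>j. e j \<omega>)) i) s \<omega>"
  define v where "v n u = velocity (d n) (?C n) u" for n u
  define w where "w u = real_of_int \<sigma> * telegraph_sign a b e u \<omega>" for u
  have C: "\<bar>?C n i\<bar> \<le> 1" for n i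
    using \<sigma> by (simp add: coupled_chain_def abs_mult power_abs)
  have \<sigma>': "\<bar>real_of_int \<sigma>\<bar> = 1"
    using \<sigma> by (metis of_int_abs of_int_1)
  have v: "v n \<in> borel_measurable borel" "\<bar>v n u\<bar> \<le> 1" for n u
    unfolding v_def[abs_def] using abs_velocity_le[of "?C n"] C by auto
  have w: "w \<in> borel_measurable borel" "\<bar>w u\<bar> \<le> 1" for u
    unfolding w_def[abs_def] by (auto simp: abs_mult \<sigma>')
  note [measurable] = v(1) w(1)
  have vw: "\<bar>v n u - w u\<bar> \<le> 2" for n u
    using v(2)[of n u] w(2)[of u] by linarith
  have X: "?X n s = d n * real_of_int \<sigma> + (LBINT u:{0..s}. v n u)" if "0 \<le> s" for n s
  proof -
    have "?C n 0 = \<sigma>"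
      by (simp add: coupled_chain_def)
    then show ?thesis
      using interpolated_walk_eq_integral[where dx = "d n" and s = s and \<omega> = \<omega> and
          Y = "\<lambda>i \<omega>. coupled_chain \<sigma> (sojourns a b (d n) (\<lambda>j. e j \<omega>)) i", OF d(2) that C]
      by (simp only: v_def)
  qed
  have Z: "real_of_int \<sigma> * telegraph_process a b e s \<omega> = (LBINT u:{0..s}. w u)" for s
    by (simp add: telegraph_process_eq w_def)
  have int_diff: "integrable lborel (\<lambda>u. indicator {0..T} u * \<bar>v n u - w u\<bar>)" for n T
  proof (rule Bochner_Integration.integrable_bound)
    show "integrable lborel (\<lambda>u. indicator {0..T} u * (2::real))"
      by (simp add: emeasure_lborel_Icc_eq)
    show "(\<lambda>u. indicator {0..T} u * \<bar>v n u - w u\<bar>) \<in> borel_measurable lborel"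
      by measurable
    show "AE u in lborel. norm (indicator {0..T} u * \<bar>v n u - w u\<bar>) \<le> norm (indicator {0..T} u * (2::real))"
      using vw[of n] by (auto simp: indicator_def)
  qed
  have lim: "(\<lambda>n. \<integral>u. indicator {0..T} u * \<bar>v n u - w u\<bar> \<partial>lborel) \<longlonglongrightarrow> 0" for T
  proof -
    have "(\<lambda>n. \<integral>u. indicator {0..T} u * \<bar>v n u - w u\<bar> \<partial>lborel) \<longlonglongrightarrow> (\<integral>u. 0 \<partial>(lborel :: real measure))"
    proof (rule integral_dominated_convergence[where w = "\<lambda>u. indicator {0..T} u * (2::real)"])
      show "integrable lborel (\<lambda>u. indicator {0..T} u * (2::real))"
        by (simp add: emeasure_lborel_Icc_eq)
      show "AE u in lborel. norm (indicator {0..T} u * \<bar>v n u - w u\<bar>) \<le> indicator {0..T} u * (2::real)" for n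
        using vw[of n] by (auto simp: indicator_def)
      \<comment> \<open>Convergence of the velocities can fail only at the jump times of the limit.\<close>
      have "AE u in lborel. u \<notin> arrival a b (\<lambda>i. e i \<omega>) ` {1..}"
        by (intro AE_not_in countable_imp_null_set_lborel) auto
      then show "AE u in lborel. (\<lambda>n. indicator {0..T} u * \<bar>v n u - w u\<bar>) \<longlonglongrightarrow> 0"
      proof eventually_elim
        case (elim u)
        show ?case
        proof (cases "0 \<le> u")
          case True
          have "(\<lambda>n. v n u) \<longlonglongrightarrow> w u"
            unfolding v_def w_def by (rule velocity_coupled_tendsto[where d = d and e = e and \<omega> = \<omega> and u = u, OF d ab small x True]) (use elim in auto)
          then have "(\<lambda>n. \<bar>v n u - w u\<bar>) \<longlonglongrightarrow> 0"
            using LIM_zero tendsto_rabs_zero by blast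
          then show ?thesis
            using tendsto_mult_right_zero by blast
        qed (simp add: indicator_def)
      qed
    qed simp_all
    then show ?thesis by simp
  qed
  have bound: "\<bar>?X n t - real_of_int \<sigma> * telegraph_process a b e t \<omega>\<bar>
      \<le> d n + (\<integral>u. indicator {0..T} u * \<bar>v n u - w u\<bar> \<partial>lborel)" if t: "t \<in> {0..T}" for n t T
  proof -
    have i: "set_integrable lborel {0..t} (v n)" "set_integrable lborel {0..t} w"
      using set_integrable_Icc_bounded v w by auto
    have "\<bar>LBINT u:{0..t}. v n u - w u\<bar> \<le> (LBINT u:{0..t}. \<bar>v n u - w u\<bar>)"
      using set_integral_norm_bound[OF set_integral_diff(1)[OF i]] by simp
    also have "\<dots> \<le> (\<integral>u. indicator {0..T} u * \<bar>v n u - w u\<bar> \<partial>lborel)"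
      unfolding set_lebesgue_integral_def real_scaleR_def
      by (rule integral_mono[OF int_diff int_diff]) (use t in \<open>auto simp: indicator_def\<close>)
    finally have "\<bar>(LBINT u:{0..t}. v n u) - (LBINT u:{0..t}. w u)\<bar>
        \<le> (\<integral>u. indicator {0..T} u * \<bar>v n u - w u\<bar> \<partial>lborel)"
      by (simp add: set_integral_diff(2)[OF i])
    moreover have "\<bar>d n * real_of_int \<sigma>\<bar> = d n"
      using \<sigma>' d(2)[of n] by (simp add: abs_mult)
    ultimately show ?thesis
      using t unfolding Z by (simp add: X)
  qed
  show ?thesis
  proof (rule tendsto_path_of)
    show "continuous_on {0..} (?X n)" for n
      by (rule unit_speed_continuous[OF unit_speed_interpolated_walk[OF d(2)]]) (rule C)
    show "continuous_on {0..} (\<lambda>s. real_of_int \<sigma> * telegraph_process a b e s \<omega>)"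
      by (rule unit_speed_continuous[OF unit_speed_telegraph[OF \<sigma>']])
    fix T \<epsilon> :: real
    assume "0 < \<epsilon>"
    have "(\<lambda>n. d n + (\<integral>u. indicator {0..T} u * \<bar>v n u - w u\<bar> \<partial>lborel)) \<longlonglongrightarrow> 0 + 0"
      by (intro tendsto_add d lim)
    then have "\<forall>\<^sub>F n in sequentially. d n + (\<integral>u. indicator {0..T} u * \<bar>v n u - w u\<bar> \<partial>lborel) < \<epsilon>"
      using \<open>0 < \<epsilon>\<close> by (intro order_tendstoD) auto
    then show "\<forall>\<^sub>F n in sequentially. \<forall>t\<in>{0..T}.
        \<bar>?X n t - real_of_int \<sigma> * telegraph_process a b e t \<omega>\<bar> < \<epsilon>"
      by eventually_elim (use bound in \<open>blast intro: le_less_trans\<close>)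
  qed
qed

text \<open>Infinitely many of the variables exceed 1 almost surely, because all variables after the
  \<open>n\<close>-th are at most 1 with probability at most \<open>q ^ m\<close> for every \<open>m\<close>, where \<open>q < 1\<close>. Each such variable
  moves the jump times on by at least the smaller of the two time scales.\<close>

lemma AE_regular_clock:
  assumes e: "iid_exponential N e" and ab: "0 < a" "0 < b"
  shows "AE \<omega> in N. regular_clock a b (\<lambda>i. e i \<omega>)"
proof -
  interpret prob_space N
    using e by (simp add: iid_exponential_def)
  have dist: "distributed N lborel (e i) (exponential_density 1)" if "1 \<le> i" for i
    using e that by (simp add: iid_exponential_def)
  have ind: "indep_vars (\<lambda>_. borel) e {1..}"
    using e by (simp add: iid_exponential_def)
  note meas = iid_exponential_borel[OF e]
  have pos: "AE \<omega> in N. 0 < e i \<omega>" if i: "1 \<le> i" for i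
  proof -
    have "\<P>(\<omega> in N. 0 < e i \<omega>) = 1"
      using exponential_distributedD_gt[OF dist[OF i], of 0] by simp
    moreover have "{\<omega> \<in> space N. 0 < e i \<omega>} \<in> events"
      using meas[OF i] by measurable
    ultimately show ?thesis
      using AE_prob_1[of "{\<omega> \<in> space N. 0 < e i \<omega>}"] by (auto elim: eventually_mono)
  qed
  have large: "AE \<omega> in N. \<exists>i>n. 1 < e i \<omega>" for n
  proof -
    define q where "q = 1 - exp (- 1 :: real)"
    have q: "0 \<le> q" "q < 1"
      by (auto simp: q_def)
    have bound: "\<P>(\<omega> in N. \<forall>i>n. e i \<omega> \<le> 1) \<le> q ^ Suc m" for m
    proof -
      have ev: "e i -` {..1} \<inter> space N \<in> events" if "i \<in> {Suc n..Suc n + m}" for i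
        using measurable_sets[OF meas, of i "{..1}"] that by auto
      have "\<P>(\<omega> in N. \<forall>i>n. e i \<omega> \<le> 1) \<le> prob (\<Inter>i\<in>{Suc n..Suc n + m}. e i -` {..1} \<inter> space N)"
      proof (rule finite_measure_mono)
        show "(\<Inter>i\<in>{Suc n..Suc n + m}. e i -` {..1} \<inter> space N) \<in> events"
          by (intro sets.finite_INT ev) simp_all
      qed auto
      also have "\<dots> = (\<Prod>i\<in>{Suc n..Suc n + m}. prob (e i -` {..1} \<inter> space N))"
        by (rule indep_varsD[OF ind]) auto
      also have "\<dots> = (\<Prod>i\<in>{Suc n..Suc n + m}. q)"
      proof (rule prod.cong[OF refl])
        fix i assume "i \<in> {Suc n..Suc n + m}"
        then have "\<P>(\<omega> in N. e i \<omega> \<le> 1) = q"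
          using exponential_distributedD_le[OF dist, of i 1] by (simp add: q_def)
        moreover have "{\<omega> \<in> space N. e i \<omega> \<le> 1} = e i -` {..1} \<inter> space N"
          by auto
        ultimately show "prob (e i -` {..1} \<inter> space N) = q"
          by simp
      qed
      finally show ?thesis
        by simp
    qed
    have "(\<lambda>m. q ^ Suc m) \<longlonglongrightarrow> 0"
      using q by (intro LIMSEQ_Suc LIMSEQ_power_zero) auto
    then have "\<P>(\<omega> in N. \<forall>i>n. e i \<omega> \<le> 1) \<le> 0"
      by (rule LIMSEQ_le_const) (use bound in auto)
    moreover have "{\<omega> \<in> space N. \<forall>i>n. e i \<omega> \<le> 1} \<in> events"
    proof -
      have "Measurable.pred N (\<lambda>\<omega>. i > n \<longrightarrow> e i \<omega> \<le> 1)" for i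
        using meas[of i] by (cases "i > n") auto
      then show ?thesis
        by measurable
    qed
    ultimately show ?thesis
    proof (intro AE_I)
      show "{\<omega> \<in> space N. \<not> (\<exists>i>n. 1 < e i \<omega>)} \<subseteq> {\<omega> \<in> space N. \<forall>i>n. e i \<omega> \<le> 1}"
      proof safe
        fix \<omega> i assume "\<not> (\<exists>i>n. 1 < e i \<omega>)" "n < i"
        then show "e i \<omega> \<le> 1"
          by (meson not_less)
      qed
      assume "\<P>(\<omega> in N. \<forall>i>n. e i \<omega> \<le> 1) \<le> 0"
      then have "\<P>(\<omega> in N. \<forall>i>n. e i \<omega> \<le> 1) = 0"
        by (simp only: measure_le_0_iff)
      then show "emeasure N {\<omega> \<in> space N. \<forall>i>n. e i \<omega> \<le> 1} = 0"
        by (simp only: emeasure_eq_measure ennreal_0)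
    qed
  qed
  have "AE \<omega> in N. \<forall>i\<in>{1..}. 0 < e i \<omega>"
    using pos by (subst AE_ball_countable) auto
  moreover have "AE \<omega> in N. \<forall>n. \<exists>i>n. 1 < e i \<omega>"
    using large by (subst AE_all_countable) auto
  ultimately show ?thesis
  proof eventually_elim
    case (elim \<omega>)
    let ?S = "arrival a b (\<lambda>i. e i \<omega>)"
    define c where "c = min (1 / a) (1 / b)"
    have c: "0 < c" "c \<le> jump_scale a b i" for i
      using ab by (auto simp: c_def jump_scale_def)
    have S_Suc: "?S k \<le> ?S (Suc k)" for k
    proof -
      have "0 < jump_scale a b (Suc k) * e (Suc k) \<omega>"
        using elim(1) c(1) c(2)[of "Suc k"] by (intro mult_pos_pos) auto
      then show ?thesis
        by (simp add: arrival_def)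
    qed
    then have S_mono: "?S j \<le> ?S k" if "j \<le> k" for j k
      using that by (rule lift_Suc_mono_le)
    have step: "\<exists>m. ?S k + c < ?S m" for k
    proof -
      obtain i where i: "k < i" "1 < e i \<omega>"
        using elim(2) by blast
      then obtain j where j: "i = Suc j"
        by (cases i) auto
      have "c * 1 < jump_scale a b i * e i \<omega>"
        using c(1) c(2)[of i] i(2) by (intro mult_le_less_imp_less) auto
      then have "?S j + c < ?S i"
        by (simp add: arrival_def j)
      then show ?thesis
        using S_mono[of k j] i j by (intro exI[of _ i]) auto
    qed
    have "\<exists>m. real n * c \<le> ?S m" for n
    proof (induction n)
      case 0
      show ?case by (rule exI[of _ 0]) (simp add: arrival_def)
    next
      case (Suc n)
      then obtain m where "real n * c \<le> ?S m" by blast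
      moreover obtain m' where "?S m + c < ?S m'"
        using step by blast
      ultimately have "real (Suc n) * c \<le> ?S m'"
        by (simp add: algebra_simps)
      then show ?case by blast
    qed
    moreover have "\<exists>n. u < real n * c" for u
      using reals_Archimedean3[OF c(1)] by blast
    ultimately show ?case
      using elim(1) unfolding regular_clock_def by (meson atLeast_iff less_le_trans)
  qed
qed

text \<open>Weak convergence depends on the laws only, so the given walks may be replaced by the coupled
  ones, which converge almost surely. Dominated convergence is applied along an arbitrary sequence of
  step sizes below \<open>b0\<close>, where both switching probabilities are less than 1.\<close>

lemma converges_in_distribution_telegraph:
  assumes c: "0 < c0" "0 < c1" and e: "iid_exponential N e"
    and \<sigma>: "\<sigma> = -1 \<and> a = c0 \<and> b = c1 \<or> \<sigma> = 1 \<and> a = c1 \<and> b = c0"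
    and mc: "\<forall>\<^sub>F dx in at_right 0. markov_chain (M dx) {-1, 1} (transition c0 c1 dx) (Y dx) \<and>
          (AE \<omega> in M dx. Y dx 0 \<omega> = \<sigma>)"
  shows "converges_in_distribution M (\<lambda>dx. interpolated_walk dx dx (Y dx))
          N (\<lambda>s \<omega>. real_of_int \<sigma> * telegraph_process a b e s \<omega>) (at_right 0)"
  unfolding converges_in_distribution_def
proof (intro conjI)
  let ?Z = "\<lambda>s \<omega>. real_of_int \<sigma> * telegraph_process a b e s \<omega>"
  let ?V = "\<lambda>dx. interpolated_walk dx dx (\<lambda>i \<omega>. coupled_chain \<sigma> (sojourns a b dx (\<lambda>j. e j \<omega>)) i)"
  have ab: "0 < a" "0 < b" and \<sigma>1: "\<bar>\<sigma>\<bar> = 1" "\<bar>real_of_int \<sigma>\<bar> = 1"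
    using \<sigma> c by auto
  interpret N: prob_space N
    using e by (simp add: iid_exponential_def)
  show Z: "continuous_process N ?Z"
    by (rule continuous_process_telegraph[OF e \<sigma>1(2)])
  have pos: "\<forall>\<^sub>F dx in at_right 0. 0 < (dx :: real)"
    by (rule eventually_at_right_less)
  show "\<forall>\<^sub>F dx in at_right 0. continuous_process (M dx) (interpolated_walk dx dx (Y dx))"
    using mc pos
  proof eventually_elim
    case (elim dx)
    then have Y: "Y dx n \<in> M dx \<rightarrow>\<^sub>M count_space {-1, 1}" for n
      by (simp add: markov_chain_def)
    have "\<bar>Y dx i \<omega>\<bar> \<le> 1" if "\<omega> \<in> space (M dx)" for i \<omega>
      using measurable_space[OF Y that, of i] by auto
    then show ?case
      unfolding continuous_process_def using elim interpolated_walk_path_measurable[OF _ Y]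
      by (auto simp: markov_chain_def intro!: unit_speed_continuous unit_speed_interpolated_walk)
  qed
  define b0 where "b0 = min (1 / a) (1 / b)"
  have b0: "0 < b0" "a * dx < 1" "b * dx < 1" if "0 < dx" "dx < b0" for dx
    using ab that by (auto simp: b0_def field_simps)
  have small: "\<forall>\<^sub>F dx in at_right 0. dx < b0"
    using ab by (intro eventually_at_rightI[of 0 b0]) (auto simp: b0_def)
  have V: "(\<lambda>\<omega>. path_of (\<lambda>s. ?V dx s \<omega>)) \<in> N \<rightarrow>\<^sub>M borel" if "0 < dx" "dx < b0" for dx
  proof (rule interpolated_walk_path_measurable[OF that(1)])
    show "(\<lambda>\<omega>. coupled_chain \<sigma> (sojourns a b dx (\<lambda>j. e j \<omega>)) n) \<in> N \<rightarrow>\<^sub>M count_space {-1, 1}" for n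
      using coupled_chain_measurable[OF iid_exponential_sojourns(3)[OF e ab that(1) b0(2,3)[OF that]],
          where \<sigma> = \<sigma> and n = n] \<sigma> by auto
  qed
  show "weakly_converges (\<lambda>dx. path_law (M dx) (interpolated_walk dx dx (Y dx))) (path_law N ?Z) (at_right 0)"
    unfolding weakly_converges_def
  proof (intro allI impI, elim conjE)
    fix \<phi> :: "cpath \<Rightarrow> real"
    assume \<phi>: "continuous_on UNIV \<phi>" and bdd: "bounded (range \<phi>)"
    have \<phi>m: "\<phi> \<in> borel_measurable borel"
      by (rule borel_measurable_continuous_onI[OF \<phi>])
    obtain B where B: "\<bar>\<phi> p\<bar> \<le> B" for p
      using bdd by (auto simp: bounded_iff)
    have Zm: "(\<lambda>\<omega>. path_of (\<lambda>s. ?Z s \<omega>)) \<in> N \<rightarrow>\<^sub>M borel"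
      using Z by (simp add: continuous_process_def)
    have "((\<lambda>dx. \<integral>\<omega>. \<phi> (path_of (\<lambda>s. ?V dx s \<omega>)) \<partial>N) \<longlongrightarrow> (\<integral>\<omega>. \<phi> (path_of (\<lambda>s. ?Z s \<omega>)) \<partial>N)) (at_right 0)"
    proof (rule tendsto_at_right_sequentially)
      show "0 < b0"
        using ab by (simp add: b0_def)
      fix d :: "nat \<Rightarrow> real"
      assume d: "\<And>n. 0 < d n" "\<And>n. d n < b0" "d \<longlonglongrightarrow> 0"
      show "(\<lambda>n. \<integral>\<omega>. \<phi> (path_of (\<lambda>s. ?V (d n) s \<omega>)) \<partial>N) \<longlonglongrightarrow> (\<integral>\<omega>. \<phi> (path_of (\<lambda>s. ?Z s \<omega>)) \<partial>N)"
      proof (rule integral_dominated_convergence[where w = "\<lambda>_. B"])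
        show "(\<lambda>\<omega>. \<phi> (path_of (\<lambda>s. ?Z s \<omega>))) \<in> borel_measurable N"
          by (rule measurable_compose[OF Zm \<phi>m])
        show "(\<lambda>\<omega>. \<phi> (path_of (\<lambda>s. ?V (d n) s \<omega>))) \<in> borel_measurable N" for n
          by (rule measurable_compose[OF V[OF d(1,2)] \<phi>m])
        show "AE \<omega> in N. (\<lambda>n. \<phi> (path_of (\<lambda>s. ?V (d n) s \<omega>))) \<longlonglongrightarrow> \<phi> (path_of (\<lambda>s. ?Z s \<omega>))"
          using AE_regular_clock[OF e ab]
        proof eventually_elim
          case (elim \<omega>)
          show ?case
            by (rule continuous_on_tendsto_compose[OF \<phi> coupled_path_tendsto[where d = d and e = e and \<omega> = \<omega>, OF d(3,1) ab b0(2,3)[OF d(1,2)] elim \<sigma>1(1)]])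
               auto
        qed
      qed (use B in auto)
    qed
    moreover have "(\<integral>p. \<phi> p \<partial>path_law N ?Z) = (\<integral>\<omega>. \<phi> (path_of (\<lambda>s. ?Z s \<omega>)) \<partial>N)"
      unfolding path_law_def by (rule integral_distr[OF Zm \<phi>m])
    moreover have "\<forall>\<^sub>F dx in at_right 0. (\<integral>\<omega>. \<phi> (path_of (\<lambda>s. ?V dx s \<omega>)) \<partial>N)
        = (\<integral>p. \<phi> p \<partial>path_law (M dx) (interpolated_walk dx dx (Y dx)))"
      using mc pos small
    proof eventually_elim
      case (elim dx)
      then have "path_law (M dx) (interpolated_walk dx dx (Y dx)) = path_law N (?V dx)"
        by (intro path_law_coupled[OF e ab _ _ _ \<sigma>] b0) auto
      also have "(\<integral>p. \<phi> p \<partial>path_law N (?V dx)) = (\<integral>\<omega>. \<phi> (path_of (\<lambda>s. ?V dx s \<omega>)) \<partial>N)"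
        unfolding path_law_def by (rule integral_distr[OF V[OF elim(2,3)] \<phi>m])
      finally show ?case by simp
    qed
    ultimately show "((\<lambda>dx. \<integral>p. \<phi> p \<partial>path_law (M dx) (interpolated_walk dx dx (Y dx)))
        \<longlongrightarrow> (\<integral>p. \<phi> p \<partial>path_law N ?Z)) (at_right 0)"
      using Lim_transform_eventually by fastforce
  qed
qed

section \<open>Bernoulli trials\<close>

text \<open>The assumption identifies the law of the sequence with the product measure, and product laws
  characterise independence.\<close>

lemma iid_of_prefix_probs:
  fixes X :: "nat \<Rightarrow> 'a \<Rightarrow> 's::finite" and q :: "'s pmf"
  assumes N: "prob_space N" and X: "\<And>n. X n \<in> N \<rightarrow>\<^sub>M count_space UNIV"
    and prefix: "\<And>n w. \<P>(\<omega> in N. \<forall>i\<le>n. X i \<omega> = w i) = (\<Prod>i\<le>n. pmf q (w i))"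
  shows "prob_space.indep_vars N (\<lambda>_. count_space UNIV) X UNIV"
    and "distr N (count_space UNIV) (X i) = measure_pmf q"
proof -
  interpret prob_space N by fact
  define P where "P = PiM (UNIV :: nat set) (\<lambda>_. measure_pmf q)"
  define Q where "Q = PiM (UNIV :: nat set) (\<lambda>_. count_space (UNIV :: 's set))"
  interpret P: product_prob_space "\<lambda>_. measure_pmf q" "UNIV :: nat set"
    by unfold_locales
  have sets: "sets P = sets Q"
    unfolding P_def Q_def by (intro sets_PiM_cong) auto
  have coord: "(\<lambda>\<omega>. \<omega> i) \<in> P \<rightarrow>\<^sub>M count_space UNIV" for i
    using measurable_component_singleton[of i UNIV "\<lambda>_. measure_pmf q"] by (simp add: P_def)
  have "distr N Q (\<lambda>\<omega> n. X n \<omega>) = distr P Q (\<lambda>\<omega> n. \<omega> n)"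
    unfolding Q_def
  proof (rule distr_sequence_eqI[where Z = "\<lambda>n \<omega>. \<omega> n", OF N _ _ X coord])
    show "prob_space P"
      unfolding P_def by (rule P.P.prob_space_axioms)
    fix n and w :: "nat \<Rightarrow> 's"
    have "emeasure P {\<omega> \<in> space P. \<forall>i\<in>{..n}. \<omega> i \<in> {w i}} = (\<Prod>i\<le>n. emeasure (measure_pmf q) {w i})"
      unfolding P_def by (rule P.emeasure_PiM_Collect) auto
    then have "\<P>(\<omega> in P. \<forall>i\<le>n. \<omega> i = w i) = (\<Prod>i\<le>n. pmf q (w i))"
      by (simp add: measure_def Ball_def emeasure_pmf_single prod_ennreal prod_nonneg)
    then show "\<P>(\<omega> in N. \<forall>i\<le>n. X i \<omega> = w i) = \<P>(\<omega> in P. \<forall>i\<le>n. \<omega> i = w i)"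
      by (simp only: prefix)
  qed simp
  also have "\<dots> = P"
    by (rule distr_id2[OF sets[symmetric], unfolded id_def]) 
  finally have law: "distr N Q (\<lambda>\<omega> n. X n \<omega>) = P" .
  have meas: "(\<lambda>\<omega> n. X n \<omega>) \<in> N \<rightarrow>\<^sub>M Q"
    unfolding Q_def by (intro measurable_PiM_single') (auto intro: X)
  have marginal: "distr N (count_space UNIV) (X i) = measure_pmf q" for i
  proof -
    have "distr N (count_space UNIV) (X i) = distr (distr N Q (\<lambda>\<omega> n. X n \<omega>)) (count_space UNIV) (\<lambda>\<omega>. \<omega> i)"
      by (subst distr_distr[OF _ meas]) (auto simp: Q_def comp_def)
    also have "\<dots> = distr P (measure_pmf q) (\<lambda>\<omega>. \<omega> i)"
      unfolding law by (rule distr_cong) auto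
    also have "\<dots> = measure_pmf q"
      unfolding P_def by (rule P.PiM_component) simp
    finally show ?thesis .
  qed
  then show "distr N (count_space UNIV) (X i) = measure_pmf q" .
  show "indep_vars (\<lambda>_. count_space UNIV) X UNIV"
    using law X by (subst indep_vars_iff_distr_eq_PiM') (auto simp: P_def Q_def marginal restrict_UNIV)
qed

text \<open>The binomial law, obtained by summing over the sets of successes.\<close>

lemma (in prob_space) prob_bernoulli_count:
  assumes ind: "indep_vars (\<lambda>_. count_space UNIV) B (UNIV :: nat set)"
    and p: "\<And>i. \<P>(\<omega> in M. B i \<omega>) = p" and J: "finite J"
  shows "\<P>(\<omega> in M. card {j \<in> J. B j \<omega>} = k) = real (card J choose k) * p ^ k * (1 - p) ^ (card J - k)"
proof -
  have B: "B i \<in> M \<rightarrow>\<^sub>M count_space UNIV" for i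
    using ind by (auto simp: indep_vars_def2)
  have [measurable]: "{\<omega> \<in> space M. B i \<omega> = c} \<in> events" for i c
    using measurable_sets[OF B, of "{c}" i] by (simp add: vimage_def Int_def conj_commute)
  have p': "\<P>(\<omega> in M. \<not> B i \<omega>) = 1 - p" for i
  proof -
    have "prob {\<omega> \<in> space M. \<not> B i \<omega>} = 1 - prob {\<omega> \<in> space M. B i \<omega>}"
      using prob_neg[of "B i"] measurable_sets[OF B, of "{True}" i]
      by (simp add: vimage_def Int_def conj_commute)
    then show ?thesis
      by (simp add: p)
  qed
  have word: "\<P>(\<omega> in M. \<forall>j\<in>J. B j \<omega> = (j \<in> T)) = p ^ card T * (1 - p) ^ (card J - card T)"
    if T: "T \<subseteq> J" for T
  proof (cases "J = {}")
    case True
    then show ?thesis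
      using T by (simp add: prob_space)
  next
    case False
    have "{\<omega> \<in> space M. \<forall>j\<in>J. B j \<omega> = (j \<in> T)} = (\<Inter>j\<in>J. B j -` {j \<in> T} \<inter> space M)"
      using False by auto
    also have "prob \<dots> = (\<Prod>j\<in>J. prob (B j -` {j \<in> T} \<inter> space M))"
      by (rule indep_varsD[OF ind False J]) auto
    also have "\<dots> = (\<Prod>j\<in>J. if j \<in> T then p else 1 - p)"
    proof (rule prod.cong[OF refl])
      fix j
      have "B j -` {j \<in> T} \<inter> space M = {\<omega> \<in> space M. B j \<omega> = (j \<in> T)}"
        by auto
      then show "prob (B j -` {j \<in> T} \<inter> space M) = (if j \<in> T then p else 1 - p)"
        using p[of j] p'[of j] by simp
    qed
    also have "\<dots> = p ^ card T * (1 - p) ^ card (J - T)"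
      using T J by (simp add: prod.If_cases Int_absorb1 Diff_eq)
    finally show ?thesis
      using T J by (simp add: card_Diff_subset finite_subset)
  qed
  let ?T = "{T. T \<subseteq> J \<and> card T = k}"
  have "{\<omega> \<in> space M. card {j \<in> J. B j \<omega>} = k} = (\<Union>T\<in>?T. {\<omega> \<in> space M. \<forall>j\<in>J. B j \<omega> = (j \<in> T)})"
  proof (intro equalityI subsetI)
    fix \<omega> assume "\<omega> \<in> {\<omega> \<in> space M. card {j \<in> J. B j \<omega>} = k}"
    then show "\<omega> \<in> (\<Union>T\<in>?T. {\<omega> \<in> space M. \<forall>j\<in>J. B j \<omega> = (j \<in> T)})"
      by (intro UN_I[of "{j \<in> J. B j \<omega>}"]) auto
  next
    fix \<omega> assume "\<omega> \<in> (\<Union>T\<in>?T. {\<omega> \<in> space M. \<forall>j\<in>J. B j \<omega> = (j \<in> T)})"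
    then obtain T where T: "T \<subseteq> J" "card T = k" "\<omega> \<in> space M" "\<forall>j\<in>J. B j \<omega> = (j \<in> T)"
      by auto
    then have "{j \<in> J. B j \<omega>} = T"
      by auto
    with T show "\<omega> \<in> {\<omega> \<in> space M. card {j \<in> J. B j \<omega>} = k}"
      by simp
  qed
  also have "prob \<dots> = (\<Sum>T\<in>?T. \<P>(\<omega> in M. \<forall>j\<in>J. B j \<omega> = (j \<in> T)))"
  proof (rule finite_measure_finite_Union)
    show "finite ?T"
      using J by simp
    show "(\<lambda>T. {\<omega> \<in> space M. \<forall>j\<in>J. B j \<omega> = (j \<in> T)}) ` ?T \<subseteq> events"
      using J by (auto intro!: sets.sets_Collect_finite_All)
    show "disjoint_family_on (\<lambda>T. {\<omega> \<in> space M. \<forall>j\<in>J. B j \<omega> = (j \<in> T)}) ?T"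
      unfolding disjoint_family_on_def
    proof (intro ballI impI)
      fix S T assume "S \<in> ?T" "T \<in> ?T" "S \<noteq> T"
      then obtain j where "j \<in> J" "(j \<in> S) \<noteq> (j \<in> T)"
        by blast
      then show "{\<omega> \<in> space M. \<forall>j\<in>J. B j \<omega> = (j \<in> S)} \<inter> {\<omega> \<in> space M. \<forall>j\<in>J. B j \<omega> = (j \<in> T)} = {}"
        by auto
    qed
  qed
  also have "\<dots> = (\<Sum>T\<in>?T. p ^ k * (1 - p) ^ (card J - k))"
    by (rule sum.cong) (auto simp: word)
  also have "\<dots> = real (card J choose k) * p ^ k * (1 - p) ^ (card J - k)"
    by (simp add: n_subsets[OF J])
  finally show ?thesis .
qed

section \<open>Poisson approximation and regularity of the counting process\<close>

text \<open>Writing the binomial coefficient as \<open>m (m - 1) \<cdots> (m - k + 1) / k!\<close> and giving one factor \<open>p\<close> to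
  each factor yields \<open>r ^ k / k!\<close>, and \<open>(1 - p) ^ m = exp (m ln (1 - p))\<close> tends to \<open>exp (- r)\<close>.\<close>

lemma binomial_poisson_limit:
  fixes m :: "nat \<Rightarrow> nat" and p :: "nat \<Rightarrow> real"
  assumes p: "p \<longlonglongrightarrow> 0" "\<And>n. 0 < p n" "\<And>n. p n < 1" and mp: "(\<lambda>n. real (m n) * p n) \<longlonglongrightarrow> r"
  shows "(\<lambda>n. real (m n choose k) * p n ^ k * (1 - p n) ^ (m n - k)) \<longlonglongrightarrow> r ^ k / fact k * exp (- r)"
proof -
  have "(\<lambda>n. (\<Prod>i<k. real (m n) * p n - real i * p n) / fact k) \<longlonglongrightarrow> (\<Prod>i<k. r - real i * 0) / fact k"
    by (intro tendsto_intros mp p) auto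
  moreover have "real (m n choose k) * p n ^ k = (\<Prod>i<k. real (m n) * p n - real i * p n) / fact k" for n
    by (simp add: binomial_gbinomial gbinomial_prod_rev left_diff_distrib[symmetric] prod.distrib lessThan_atLeast0)
  ultimately have choose: "(\<lambda>n. real (m n choose k) * p n ^ k) \<longlonglongrightarrow> r ^ k / fact k"
    by simp
  have "(\<lambda>n. p n / - ln (1 - 1 * p n)) \<longlonglongrightarrow> 1 / 1"
    by (rule divide_minus_ln_tendsto[OF p(1,2)]) simp
  then have "(\<lambda>n. p n / - ln (1 - p n)) \<longlonglongrightarrow> 1"
    by simp
  then have inverse: "(\<lambda>n. inverse (p n / - ln (1 - p n))) \<longlonglongrightarrow> inverse 1"
    by (rule tendsto_inverse) simp
  have "(\<lambda>n. exp (- (real (m n) * p n * inverse (p n / - ln (1 - p n))))) \<longlonglongrightarrow> exp (- (r * inverse 1))"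
    by (intro tendsto_exp tendsto_minus tendsto_mult mp inverse)
  moreover have "exp (- (real (m n) * p n * inverse (p n / - ln (1 - p n)))) = (1 - p n) ^ m n" for n
  proof -
    have "real (m n) * p n * inverse (p n / - ln (1 - p n)) = - (real (m n) * ln (1 - p n))"
      using p(2)[of n] by (simp add: field_simps)
    then have "exp (- (real (m n) * p n * inverse (p n / - ln (1 - p n)))) = exp (ln (1 - p n)) ^ m n"
      by (simp flip: exp_of_nat_mult)
    then show ?thesis
      using p(3)[of n] by simp
  qed
  ultimately have power: "(\<lambda>n. (1 - p n) ^ m n) \<longlonglongrightarrow> exp (- r)"
    by simp
  \<comment> \<open>Writing the power as a quotient avoids the truncated difference; for \<open>m n < k\<close> the binomial
    coefficient vanishes.\<close>
  have "(\<lambda>n. real (m n choose k) * p n ^ k * ((1 - p n) ^ m n / (1 - p n) ^ k))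
      \<longlonglongrightarrow> r ^ k / fact k * (exp (- r) / (1 - 0) ^ k)"
    by (intro tendsto_mult choose tendsto_divide power tendsto_power tendsto_diff tendsto_const p(1)) auto
  moreover have "real (m n choose k) * p n ^ k * ((1 - p n) ^ m n / (1 - p n) ^ k)
      = real (m n choose k) * p n ^ k * (1 - p n) ^ (m n - k)" for n
  proof (cases "k \<le> m n")
    case True
    then show ?thesis
      using p(3)[of n] by (simp add: power_diff)
  next
    case False
    then show ?thesis
      by (simp add: binomial_eq_0)
  qed
  ultimately show ?thesis
    by simp
qed

lemma AE_distributed_neq:
  fixes X :: "'a \<Rightarrow> real"
  assumes "distributed M lborel X f"
  shows "AE \<omega> in M. X \<omega> \<noteq> x"
proof (rule AE_I)
  have X: "X \<in> M \<rightarrow>\<^sub>M lborel"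
    by (rule distributed_measurable[OF assms])
  show "{\<omega> \<in> space M. \<not> X \<omega> \<noteq> x} \<subseteq> X -` {x} \<inter> space M"
    by auto
  show "X -` {x} \<inter> space M \<in> sets M"
    using measurable_sets[OF X, of "{x}"] by simp
  have "emeasure M (X -` {x} \<inter> space M) = (\<integral>\<^sup>+ y. f y * indicator {x} y \<partial>lborel)"
    by (rule distributed_emeasure[OF assms]) simp
  also have "\<dots> = 0"
    by (rule nn_integral_null_set[OF countable_imp_null_set_lborel]) simp
  finally show "emeasure M (X -` {x} \<inter> space M) = 0" .
qed

text \<open>The jump times have Erlang distributions, hence densities.\<close>

lemma AE_arrival_neq:
  assumes e: "iid_exponential N e" and c: "0 < c"
  shows "AE \<omega> in N. \<forall>k\<ge>1. arrival c c (\<lambda>i. e i \<omega>) k \<noteq> t"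
proof -
  interpret prob_space N
    using e by (simp add: iid_exponential_def)
  have ind: "indep_vars (\<lambda>_. borel) e {1..}"
    and dist: "\<And>i. 1 \<le> i \<Longrightarrow> distributed N lborel (e i) (exponential_density 1)"
    using e by (simp_all add: iid_exponential_def)
  have "AE \<omega> in N. arrival c c (\<lambda>i. e i \<omega>) k \<noteq> t" if k: "1 \<le> k" for k
  proof -
    have "indep_vars (\<lambda>_. borel) e {1..k}"
      using ind by (rule indep_vars_subset) auto
    then have "distributed N lborel (\<lambda>\<omega>. \<Sum>i=1..k. e i \<omega>) (erlang_density (card {1..k} - 1) 1)"
      using k by (intro exponential_distributed_sum dist) auto
    then have "AE \<omega> in N. (\<Sum>i=1..k. e i \<omega>) \<noteq> t * c"
      by (rule AE_distributed_neq)
    then show ?thesis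
    proof eventually_elim
      case (elim \<omega>)
      have "arrival c c (\<lambda>i. e i \<omega>) k = (\<Sum>i=1..k. e i \<omega>) / c"
        by (simp add: arrival_def jump_scale_def sum_divide_distrib)
      then show ?case
        using elim c by (auto simp: field_simps)
    qed
  qed
  then have "AE \<omega> in N. \<forall>k\<in>{1..}. arrival c c (\<lambda>i. e i \<omega>) k \<noteq> t"
    by (subst AE_ball_countable) auto
  then show ?thesis
    by eventually_elim auto
qed

lemma (in prob_space) prob_tendsto_of_AE_eventually_eq:
  assumes Q: "\<And>n. {\<omega> \<in> space M. Q n \<omega>} \<in> events" "{\<omega> \<in> space M. R \<omega>} \<in> events"
    and eq: "AE \<omega> in M. \<forall>\<^sub>F n in sequentially. Q n \<omega> = R \<omega>"
  shows "(\<lambda>n. \<P>(\<omega> in M. Q n \<omega>)) \<longlonglongrightarrow> \<P>(\<omega> in M. R \<omega>)"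
proof -
  have "(\<lambda>n. \<integral>\<omega>. indicator {\<omega> \<in> space M. Q n \<omega>} \<omega> \<partial>M) \<longlonglongrightarrow> (\<integral>\<omega>. (indicator {\<omega> \<in> space M. R \<omega>} \<omega> :: real) \<partial>M)"
  proof (rule integral_dominated_convergence[where w = "\<lambda>_. 1"])
    show "AE \<omega> in M. (\<lambda>n. indicator {\<omega> \<in> space M. Q n \<omega>} \<omega>) \<longlonglongrightarrow> (indicator {\<omega> \<in> space M. R \<omega>} \<omega> :: real)"
      using eq
    proof eventually_elim
      case (elim \<omega>)
      show ?case
        by (rule tendsto_eventually, use elim in eventually_elim) (simp add: indicator_def)
    qed
  qed (use Q in \<open>auto simp: indicator_def\<close>)
  then show ?thesis
    using Q by simp
qed

lemma clock_path_properties: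
  assumes x: "regular_clock c c (\<lambda>i. e i \<omega>)" and c: "0 < c"
  shows "counting_process c c e 0 \<omega> = 0"
    and "mono (\<lambda>t. counting_process c c e t \<omega>)"
    and "continuous (at_right t) (\<lambda>u. counting_process c c e u \<omega>)"
proof -
  let ?S = "arrival c c (\<lambda>i. e i \<omega>)"
  note N_eq = counting_process_eq_card[where e = e and \<omega> = \<omega>, OF x c c]
  note S_mono = arrival_mono[OF x c c]
  have "0 < ?S k" if "1 \<le> k" for k
  proof -
    have "0 < ?S 1"
      using x c by (simp add: arrival_def jump_scale_def regular_clock_def)
    then show ?thesis
      using S_mono[OF that] by linarith
  qed
  then have "\<not> ?S k \<le> 0" if "1 \<le> k" for k
    using that by (simp only: not_le)
  then have "{k \<in> {1..}. ?S k \<le> 0} = {}"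
    by auto
  then show "counting_process c c e 0 \<omega> = 0"
    by (simp only: N_eq card.empty)
  show "mono (\<lambda>t. counting_process c c e t \<omega>)"
    unfolding N_eq by (intro monoI card_mono finite_arrivals[OF x c c]) auto
  obtain m where m: "t < ?S m"
    using x by (auto simp: regular_clock_def)
  \<comment> \<open>The next jump after \<open>t\<close>; the jump \<open>m\<close> beyond \<open>t\<close> makes the set nonempty.\<close>
  define v where "v = Min (?S ` {k. k \<le> m \<and> t < ?S k})"
  have v: "t < v" "\<And>k. k \<le> m \<Longrightarrow> t < ?S k \<Longrightarrow> v \<le> ?S k"
  proof -
    have F: "finite (?S ` {k. k \<le> m \<and> t < ?S k})" "?S ` {k. k \<le> m \<and> t < ?S k} \<noteq> {}"
      using m by auto
    show "t < v"
      unfolding v_def Min_gr_iff[OF F] by auto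
    show "v \<le> ?S k" if "k \<le> m" "t < ?S k" for k
      unfolding v_def using F(1) that by (intro Min_le) auto
  qed
  have "{k \<in> {1..}. ?S k \<le> u} = {k \<in> {1..}. ?S k \<le> t}" if u: "t < u" "u < v" for u
  proof -
    have "?S k \<le> t" if "?S k \<le> u" for k
    proof (rule ccontr)
      assume "\<not> ?S k \<le> t"
      moreover have "k \<le> m"
      proof (rule ccontr)
        assume "\<not> k \<le> m"
        then have "?S m \<le> ?S k"
          by (intro S_mono) auto
        then show False
          using v(2)[of m] m that u by auto
      qed
      ultimately show False
        using v(2)[of k] that u by auto
    qed
    then show ?thesis
      using u by force
  qed
  then have "\<forall>\<^sub>F u in at_right t. counting_process c c e u \<omega> = counting_process c c e t \<omega>"
    using v(1) unfolding N_eq by (intro eventually_at_rightI[of t v]) auto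
  then show "continuous (at_right t) (\<lambda>u. counting_process c c e u \<omega>)"
    unfolding continuous_within by (rule tendsto_eventually)
qed

section \<open>The counting process with equal rates is Poisson\<close>

text \<open>If discrete variables are almost surely eventually equal to their limits, then the probabilities
  of all events that they define converge, and the product formula survives.\<close>

lemma (in prob_space) indep_vars_limit:
  assumes ind: "\<And>n. indep_vars (\<lambda>_. count_space UNIV) (X n) I"
    and Z: "\<And>i. i \<in> I \<Longrightarrow> Z i \<in> M \<rightarrow>\<^sub>M count_space UNIV"
    and lim: "\<And>i. i \<in> I \<Longrightarrow> AE \<omega> in M. \<forall>\<^sub>F n in sequentially. X n i \<omega> = Z i \<omega>"
  shows "indep_vars (\<lambda>_. count_space UNIV) Z I"
  unfolding indep_vars_def2
proof (intro conjI ballI Z indep_setsI)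
  show "{Z i -` A \<inter> space M |A. A \<in> sets (count_space UNIV)} \<subseteq> events" if "i \<in> I" for i
    using measurable_sets[OF Z[OF that]] by auto
next
  fix A J assume J: "J \<noteq> {}" "J \<subseteq> I" "finite J"
    and "\<forall>j\<in>J. A j \<in> {Z j -` A \<inter> space M |A. A \<in> sets (count_space UNIV)}"
  then have "\<forall>j\<in>J. \<exists>C. A j = Z j -` C \<inter> space M"
    by auto
  then obtain C where C: "\<And>j. j \<in> J \<Longrightarrow> A j = Z j -` C j \<inter> space M"
    by metis
  have X: "X n i \<in> M \<rightarrow>\<^sub>M count_space UNIV" if "i \<in> I" for n i
    using ind[of n] that by (simp add: indep_vars_def2)
  have ev: "{\<omega> \<in> space M. V \<omega> \<in> D} \<in> events" if "V \<in> M \<rightarrow>\<^sub>M count_space UNIV" for V and D :: "'c set"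
    using measurable_sets[OF that, of D] by (simp add: vimage_def Int_def conj_commute)
  have single: "(\<lambda>n. \<P>(\<omega> in M. X n j \<omega> \<in> C j)) \<longlonglongrightarrow> \<P>(\<omega> in M. Z j \<omega> \<in> C j)" if j: "j \<in> J" for j
  proof (rule prob_tendsto_of_AE_eventually_eq)
    have "j \<in> I"
      using j J by auto
    then show "{\<omega> \<in> space M. X n j \<omega> \<in> C j} \<in> events" "{\<omega> \<in> space M. Z j \<omega> \<in> C j} \<in> events" for n
      by (intro ev X Z; assumption)+
    show "AE \<omega> in M. \<forall>\<^sub>F n in sequentially. (X n j \<omega> \<in> C j) = (Z j \<omega> \<in> C j)"
      using lim[OF \<open>j \<in> I\<close>] by eventually_elim (auto elim: eventually_mono)
  qed
  have joint: "(\<lambda>n. \<P>(\<omega> in M. \<forall>j\<in>J. X n j \<omega> \<in> C j)) \<longlonglongrightarrow> \<P>(\<omega> in M. \<forall>j\<in>J. Z j \<omega> \<in> C j)"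
  proof (rule prob_tendsto_of_AE_eventually_eq)
    have "j \<in> I" if "j \<in> J" for j
      using that J by auto
    then show "{\<omega> \<in> space M. \<forall>j\<in>J. X n j \<omega> \<in> C j} \<in> events" "{\<omega> \<in> space M. \<forall>j\<in>J. Z j \<omega> \<in> C j} \<in> events" for n
      by (intro sets.sets_Collect_finite_All' ev X Z J; assumption)+
    have "AE \<omega> in M. \<forall>j\<in>J. \<forall>\<^sub>F n in sequentially. X n j \<omega> = Z j \<omega>"
      using lim J by (intro AE_finite_allI) auto
    then show "AE \<omega> in M. \<forall>\<^sub>F n in sequentially. (\<forall>j\<in>J. X n j \<omega> \<in> C j) = (\<forall>j\<in>J. Z j \<omega> \<in> C j)"
    proof eventually_elim
      case (elim \<omega>)
      then have "\<forall>\<^sub>F n in sequentially. \<forall>j\<in>J. X n j \<omega> = Z j \<omega>"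
        by (rule eventually_ball_finite[OF J(3)])
      then show ?case
        by eventually_elim simp
    qed
  qed
  have "\<P>(\<omega> in M. \<forall>j\<in>J. X n j \<omega> \<in> C j) = (\<Prod>j\<in>J. \<P>(\<omega> in M. X n j \<omega> \<in> C j))" for n
  proof -
    have "{\<omega> \<in> space M. \<forall>j\<in>J. X n j \<omega> \<in> C j} = (\<Inter>j\<in>J. X n j -` C j \<inter> space M)"
      using J by auto
    also have "prob \<dots> = (\<Prod>j\<in>J. prob (X n j -` C j \<inter> space M))"
      by (rule indep_varsD[OF ind J(1,3,2)]) auto
    finally show ?thesis
      by (simp add: vimage_def Int_def conj_commute)
  qed
  then have "(\<lambda>n. \<P>(\<omega> in M. \<forall>j\<in>J. X n j \<omega> \<in> C j)) \<longlonglongrightarrow> (\<Prod>j\<in>J. \<P>(\<omega> in M. Z j \<omega> \<in> C j))"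
    using tendsto_prod[OF single] by simp
  then have "\<P>(\<omega> in M. \<forall>j\<in>J. Z j \<omega> \<in> C j) = (\<Prod>j\<in>J. \<P>(\<omega> in M. Z j \<omega> \<in> C j))"
    by (rule LIMSEQ_unique[OF joint])
  moreover have "(\<Inter>j\<in>J. A j) = {\<omega> \<in> space M. \<forall>j\<in>J. Z j \<omega> \<in> C j}"
    using J C by auto
  moreover have "A j = {\<omega> \<in> space M. Z j \<omega> \<in> C j}" if "j \<in> J" for j
    using C[OF that] by auto
  ultimately show "prob (\<Inter>j\<in>J. A j) = (\<Prod>j\<in>J. prob (A j))"
    by simp
qed

lemma (in prob_space) indep_vars_block_counts:
  assumes ind: "indep_vars (\<lambda>_. count_space UNIV) B (UNIV :: nat set)"
    and K: "\<And>i. i \<in> L \<Longrightarrow> finite (K i)" "disjoint_family_on K L"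
  shows "indep_vars (\<lambda>_. count_space UNIV) (\<lambda>i \<omega>. card {j \<in> K i. B j \<omega>}) L"
proof -
  have "indep_vars (\<lambda>_. count_space UNIV)
      (\<lambda>i \<omega>. \<Sum>j\<in>K i. of_bool (restrict (\<lambda>j. B j \<omega>) (K i) j) :: nat) L"
  proof (rule indep_vars_compose2[OF indep_vars_restrict[OF ind _ K(2)]])
    fix i assume i: "i \<in> L"
    show "(\<lambda>g. \<Sum>j\<in>K i. of_bool (g j) :: nat) \<in> PiM (K i) (\<lambda>_. count_space UNIV) \<rightarrow>\<^sub>M count_space UNIV"
      by (intro measurable_sum_count_space K(1)[OF i]
          measurable_compose[OF measurable_component_singleton, where g = of_bool]) auto
  qed simp
  then show ?thesis
    by (rule indep_vars_cong[THEN iffD1, rotated 3]) (auto simp: fun_eq_iff K(1) intro!: arg_cong[where f = card])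
qed

lemma switch_count_block:
  assumes "k \<le> l"
  shows "switch_count b k + card {j \<in> {k..<l}. b (Suc j)} = switch_count b l"
  using assms
proof (induction l rule: dec_induct)
  case (step l)
  have "{j \<in> {k..<Suc l}. b (Suc j)}
      = (if b (Suc l) then insert l {j \<in> {k..<l}. b (Suc j)} else {j \<in> {k..<l}. b (Suc j)})"
    using step.hyps by (auto simp: less_Suc_eq)
  then show ?case
    using step.IH by (simp add: switch_count_Suc)
qed simp

text \<open>At a fixed time that is not a jump time, the number of switches of the coupled chain is eventually
  the number of jumps of the limit.\<close>

lemma grid_count_eventually:
  fixes d :: "nat \<Rightarrow> real"
  assumes d: "d \<longlonglongrightarrow> 0" "\<And>n. 0 < d n" and c: "0 < c" "\<And>n. c * d n < 1"
    and x: "regular_clock c c (\<lambda>i. e i \<omega>)"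
    and t: "0 \<le> t" "\<And>k. 1 \<le> k \<Longrightarrow> arrival c c (\<lambda>i. e i \<omega>) k \<noteq> t"
  shows "\<forall>\<^sub>F n in sequentially.
    switch_count (switches (sojourns c c (d n) (\<lambda>i. e i \<omega>))) (nat \<lfloor>t / d n\<rfloor>) = counting_process c c e t \<omega>"
proof -
  let ?g = "\<lambda>n. sojourns c c (d n) (\<lambda>i. e i \<omega>)"
  let ?s = "\<lambda>n k. d n * real (\<Sum>i=1..k. ?g n i)"
  obtain m where m: "t < arrival c c (\<lambda>i. e i \<omega>) m"
    using x by (auto simp: regular_clock_def)
  have "\<forall>\<^sub>F n in sequentially. {k \<in> {1..}. ?s n k \<le> t} = {k \<in> {1..}. arrival c c (\<lambda>i. e i \<omega>) k \<le> t}"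
  proof (rule eventually_same_arrivals[where u = t and S = "arrival c c (\<lambda>i. e i \<omega>)", OF _ _ m t(2)])
    show "(\<lambda>n. ?s n k) \<longlonglongrightarrow> arrival c c (\<lambda>i. e i \<omega>) k" for k
      by (rule scaled_switch_time_tendsto[OF d c(1,1,2,2) x])
    show "?s n j \<le> ?s n k" if "j \<le> k" for n j k
      using d(2)[of n] that by (auto intro!: mult_left_mono sum_mono2 simp flip: of_nat_sum)
  qed
  then show ?thesis
  proof eventually_elim
    case (elim n)
    have "i \<le> nat \<lfloor>t / d n\<rfloor> \<longleftrightarrow> d n * real i \<le> t" for i :: nat
    proof -
      have "i \<le> nat \<lfloor>t / d n\<rfloor> \<longleftrightarrow> real i \<le> t / d n"
        using t(1) d(2)[of n] by (simp add: le_nat_iff le_floor_iff)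
      then show ?thesis
        using d(2)[of n] by (simp add: field_simps)
    qed
    then have "switch_count (switches (?g n)) (nat \<lfloor>t / d n\<rfloor>) = card {k \<in> {1..}. ?s n k \<le> t}"
      unfolding switch_count_eq_card[of "?g n", OF sojourns_pos] by simp
    then show ?case
      by (simp only: elim counting_process_eq_card[where e = e and \<omega> = \<omega>, OF x c(1,1)])
  qed
qed

lemma scaled_grid_index_tendsto:
  fixes d :: "nat \<Rightarrow> real"
  assumes d: "d \<longlonglongrightarrow> 0" "\<And>n. 0 < d n" and t: "0 \<le> t"
  shows "(\<lambda>n. d n * real (nat \<lfloor>t / d n\<rfloor>)) \<longlonglongrightarrow> t"
proof -
  have "(\<lambda>n. d n * real (nat \<lfloor>t / d n\<rfloor>) - t) \<longlonglongrightarrow> 0"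
  proof (rule Lim_null_comparison[OF always_eventually d(1)], rule allI)
    fix n
    define z where "z = t / d n"
    have t_eq: "t = d n * z"
      using d(2)[of n] by (simp add: z_def)
    have "0 \<le> z"
      using t d(2)[of n] by (simp add: z_def)
    then have "\<bar>real (nat \<lfloor>z\<rfloor>) - z\<bar> \<le> 1"
      by linarith
    then have "d n * \<bar>real (nat \<lfloor>z\<rfloor>) - z\<bar> \<le> d n * 1"
      using d(2)[of n] by (intro mult_left_mono) auto
    then have "\<bar>d n * real (nat \<lfloor>z\<rfloor>) - t\<bar> \<le> d n"
      using d(2)[of n] unfolding t_eq by (simp add: abs_mult flip: right_diff_distrib)
    then show "norm (d n * real (nat \<lfloor>t / d n\<rfloor>) - t) \<le> d n"
      by (simp only: z_def real_norm_def)
  qed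
  then show ?thesis
    by (rule LIM_zero_cancel)
qed

text \<open>Increments over disjoint intervals are limits of the numbers of successes in disjoint blocks of
  Bernoulli trials; every fixed time is almost surely not a jump time, which makes the limits exact.\<close>

theorem poisson_process_counting:
  assumes e: "iid_exponential N e" and c: "0 < c"
  shows "poisson_process N c (counting_process c c e)"
proof -
  interpret prob_space N
    using e by (simp add: iid_exponential_def)
  let ?N = "counting_process c c e"
  \<comment> \<open>Any positive step sizes tending to 0 with \<open>c * d n < 1\<close> would do.\<close>
  define d where "d n = 1 / (c * (real n + 2))" for n
  have d: "d \<longlonglongrightarrow> 0" "\<And>n. 0 < d n" and cd: "\<And>n. c * d n < 1"
  proof -
    have "(\<lambda>n. 1 / c * (1 / real (n + 2))) \<longlonglongrightarrow> 1 / c * 0"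
      by (intro tendsto_mult tendsto_const LIMSEQ_ignore_initial_segment[OF lim_1_over_n])
    then show "d \<longlonglongrightarrow> 0"
      by (simp add: d_def[abs_def] add.commute)
    show "0 < d n" "c * d n < 1" for n
      using c by (auto simp: d_def)
  qed
  define p where "p n = c * d n" for n
  have p: "p \<longlonglongrightarrow> 0" "\<And>n. 0 < p n" "\<And>n. p n < 1"
    using tendsto_mult_right_zero[OF d(1), of c] d(2) cd c by (auto simp: p_def[abs_def])
  \<comment> \<open>Trial number \<open>i\<close> is the switch at step \<open>i + 1\<close>, so that the steps in \<open>(m n s, m n t]\<close> are the trials
    in \<open>[m n s, m n t)\<close>.\<close>
  define B where "B n i \<omega> = switches (sojourns c c (d n) (\<lambda>j. e j \<omega>)) (Suc i)" for n i \<omega>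
  define m where "m n t = nat \<lfloor>t / d n\<rfloor>" for n t
  define D where "D n s t \<omega> = int (card {j \<in> {m n s..<m n t}. B n j \<omega>})" for n s t \<omega>
  have m_mono: "m n s \<le> m n t" if "s \<le> t" for n s t
    using that d(2)[of n] by (auto simp: m_def intro!: nat_mono floor_mono divide_right_mono)
  have B: "B n i \<in> N \<rightarrow>\<^sub>M count_space UNIV" for n i
    unfolding B_def by (intro switches_measurable iid_exponential_sojourns(3)[OF e c c d(2) cd cd])
  have prefix: "\<P>(\<omega> in N. \<forall>i\<le>l. B n i \<omega> = w i) = (\<Prod>i\<le>l. pmf (bernoulli_pmf (p n)) (w i))" for n l w
  proof -
    have "(\<forall>i\<le>l. B n i \<omega> = w i) \<longleftrightarrow>
        (\<forall>i\<in>{1..Suc l}. switches (sojourns c c (d n) (\<lambda>j. e j \<omega>)) i = w (i - 1))" for \<omega>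
    proof -
      have "{1..Suc l} = Suc ` {..l}"
        by (simp add: image_Suc_atMost)
      then show ?thesis
        by (simp only: ball_simps B_def diff_Suc_1) auto
    qed
    then have "\<P>(\<omega> in N. \<forall>i\<le>l. B n i \<omega> = w i)
        = \<P>(\<omega> in N. \<forall>i\<in>{1..Suc l}. switches (\<lambda>i. sojourns c c (d n) (\<lambda>j. e j \<omega>) i) i = w (i - 1))"
      by simp
    also have "\<dots> = (\<Prod>i<Suc l. if w (Suc i - 1) then rate c c (Suc (switch_count (\<lambda>i. w (i - 1)) i)) * d n
        else 1 - rate c c (Suc (switch_count (\<lambda>i. w (i - 1)) i)) * d n)"
      by (rule prob_switch_word[OF iid_exponential_sojourns(1)[OF e c c d(2) cd cd] sojourns_pos
            iid_exponential_sojourns(2)[OF e c c d(2) cd cd]])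
    also have "\<dots> = (\<Prod>i\<le>l. pmf (bernoulli_pmf (p n)) (w i))"
      using p(2,3)[of n] unfolding lessThan_Suc_atMost
      by (intro prod.cong) (auto simp: rate_def p_def less_imp_le pmf_bernoulli_True pmf_bernoulli_False)
    finally show ?thesis .
  qed
  note iid = iid_of_prefix_probs[where q = "bernoulli_pmf (p n)" for n, OF prob_space_axioms B prefix]
  have prob_B: "\<P>(\<omega> in N. B n i \<omega>) = p n" for n i
  proof -
    have "measure (distr N (count_space UNIV) (B n i)) {True} = prob (B n i -` {True} \<inter> space N)"
      by (rule measure_distr[OF B]) simp
    then show ?thesis
      using p(2,3)[of n] by (simp add: iid(2) measure_pmf_single less_imp_le vimage_def Int_def conj_commute)
  qed
  have meas: "?N t \<in> N \<rightarrow>\<^sub>M count_space UNIV" for t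
    using counting_process_measurable[where e = e and t = "\<lambda>_. t", OF iid_exponential_borel[OF e]] by simp
  have meas_diff: "(\<lambda>\<omega>. int (?N t \<omega>) - int (?N s \<omega>)) \<in> N \<rightarrow>\<^sub>M count_space UNIV" for s t
    using meas[of s] meas[of t] by measurable
  have lim: "AE \<omega> in N. \<forall>\<^sub>F n in sequentially. D n s t \<omega> = int (?N t \<omega>) - int (?N s \<omega>)"
    if st: "0 \<le> s" "s \<le> t" for s t
    using AE_regular_clock[OF e c c] AE_arrival_neq[OF e c, of s] AE_arrival_neq[OF e c, of t]
  proof eventually_elim
    case (elim \<omega>)
    have grid: "\<forall>\<^sub>F n in sequentially. switch_count (switches (sojourns c c (d n) (\<lambda>i. e i \<omega>))) (m n u) = ?N u \<omega>"
      if "0 \<le> u" "\<forall>k\<ge>1. arrival c c (\<lambda>i. e i \<omega>) k \<noteq> u" for u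
      unfolding m_def by (rule grid_count_eventually[where d = d and e = e and \<omega> = \<omega> and t = u, OF d c cd elim(1)])
          (use that in auto)
    from grid[OF st(1) elim(2)] grid[OF order_trans[OF st] elim(3)] show ?case
    proof eventually_elim
      case (elim n)
      show ?case
        using switch_count_block[OF m_mono[OF st(2)], where b = "switches (sojourns c c (d n) (\<lambda>i. e i \<omega>))", of n] elim
        by (simp add: D_def B_def)
    qed
  qed
  show ?thesis
    unfolding poisson_process_def
  proof (intro conjI allI impI)
    show "prob_space N"
      by (rule prob_space_axioms)
    show "AE \<omega> in N. ?N 0 \<omega> = 0 \<and> mono_on {0..} (\<lambda>t. ?N t \<omega>) \<and>
        (\<forall>t\<ge>0. continuous (at_right t) (\<lambda>u. ?N u \<omega>))"
      using AE_regular_clock[OF e c c]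
      by eventually_elim (auto simp: clock_path_properties c intro: mono_imp_mono_on)
  next
    fix l and t :: "nat \<Rightarrow> real"
    assume t: "0 \<le> t 0 \<and> (\<forall>i<l. t i \<le> t (Suc i))"
    have t_mono: "t i \<le> t j" if "i \<le> j" "j \<le> l" for i j
      using that by (induction j rule: dec_induct) (use t in \<open>auto intro: order_trans\<close>)
    show "indep_vars (\<lambda>_. count_space UNIV) (\<lambda>i \<omega>. int (?N (t (Suc i)) \<omega>) - int (?N (t i) \<omega>)) {..<l}"
    proof (rule indep_vars_limit[where X = "\<lambda>n i. D n (t i) (t (Suc i))"])
      fix n
      have "disjoint_family_on (\<lambda>i. {m n (t i)..<m n (t (Suc i))}) {..<l}"
        unfolding disjoint_family_on_def
      proof (intro ballI impI)
        fix i j assume ij: "i \<in> {..<l}" "j \<in> {..<l}" "i \<noteq> j"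
        then have "t (Suc i) \<le> t j \<or> t (Suc j) \<le> t i"
          using t_mono[of "Suc i" j] t_mono[of "Suc j" i] by force
        then have "m n (t (Suc i)) \<le> m n (t j) \<or> m n (t (Suc j)) \<le> m n (t i)"
          using m_mono by blast
        then show "{m n (t i)..<m n (t (Suc i))} \<inter> {m n (t j)..<m n (t (Suc j))} = {}"
          by auto
      qed
      then show "indep_vars (\<lambda>_. count_space UNIV) (\<lambda>i. D n (t i) (t (Suc i))) {..<l}"
        unfolding D_def by (intro indep_vars_compose2[OF indep_vars_block_counts[OF iid(1)]]) auto
    next
      fix i assume i: "i \<in> {..<l}"
      show "AE \<omega> in N. \<forall>\<^sub>F n in sequentially. D n (t i) (t (Suc i)) \<omega>
          = int (?N (t (Suc i)) \<omega>) - int (?N (t i) \<omega>)"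
        using t_mono[of 0 i] i t by (intro lim) auto
    qed (rule meas_diff)
  next
    fix s t :: real
    assume st: "0 \<le> s \<and> s < t"
    show "distr N (count_space UNIV) (\<lambda>\<omega>. int (?N t \<omega>) - int (?N s \<omega>))
        = measure_pmf (map_pmf int (poisson_pmf (c * (t - s))))"
    proof (rule measure_eqI_countable[where A = UNIV])
      fix z :: int
      have "{\<omega> \<in> space N. int (?N t \<omega>) - int (?N s \<omega>) = z} \<in> events"
        using measurable_sets[OF meas_diff, of "{z}" t s] by (simp add: vimage_def Int_def conj_commute)
      moreover have "{\<omega> \<in> space N. D n s t \<omega> = z} \<in> events" for n
      proof -
        have "indep_vars (\<lambda>_. count_space UNIV) (\<lambda>i \<omega>. card {j \<in> {m n s..<m n t}. B n j \<omega>}) {()}"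
          by (rule indep_vars_block_counts[OF iid(1)]) (simp_all add: disjoint_family_on_def)
        then have "(\<lambda>\<omega>. card {j \<in> {m n s..<m n t}. B n j \<omega>}) \<in> N \<rightarrow>\<^sub>M count_space UNIV"
          unfolding indep_vars_def2 by blast
        then have "D n s t \<in> N \<rightarrow>\<^sub>M count_space UNIV"
          unfolding D_def by (rule measurable_compose) simp
        then show ?thesis
          using measurable_sets[of "D n s t" N "count_space UNIV" "{z}"]
          by (simp add: vimage_def Int_def conj_commute)
      qed
      ultimately have conv: "(\<lambda>n. \<P>(\<omega> in N. D n s t \<omega> = z)) \<longlonglongrightarrow> \<P>(\<omega> in N. int (?N t \<omega>) - int (?N s \<omega>) = z)"
        using lim[of s t] st
        by (intro prob_tendsto_of_AE_eventually_eq) (auto elim!: eventually_mono)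
      have "(\<lambda>n. \<P>(\<omega> in N. D n s t \<omega> = z)) \<longlonglongrightarrow> pmf (map_pmf int (poisson_pmf (c * (t - s)))) z"
      proof (cases "0 \<le> z")
        case True
        then obtain k where k: "z = int k"
          by (auto elim: nonneg_int_cases)
        have prob_D: "\<P>(\<omega> in N. D n s t \<omega> = z)
            = real (m n t - m n s choose k) * p n ^ k * (1 - p n) ^ (m n t - m n s - k)" for n
          using prob_bernoulli_count[OF iid(1) prob_B, of "{m n s..<m n t}" n k] by (simp add: D_def k)
        have "(\<lambda>n. real (m n t - m n s) * p n) \<longlonglongrightarrow> c * (t - s)"
        proof -
          have "(\<lambda>n. c * (d n * real (m n t) - d n * real (m n s))) \<longlonglongrightarrow> c * (t - s)"
            unfolding m_def using st
            by (intro tendsto_mult tendsto_const tendsto_diff scaled_grid_index_tendsto d) auto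
          moreover have "c * (d n * real (m n t) - d n * real (m n s)) = real (m n t - m n s) * p n" for n
            using m_mono[of s t n] st by (simp add: p_def of_nat_diff algebra_simps)
          ultimately show ?thesis
            by simp
        qed
        then have "(\<lambda>n. \<P>(\<omega> in N. D n s t \<omega> = z))
            \<longlonglongrightarrow> (c * (t - s)) ^ k / fact k * exp (- (c * (t - s)))"
          unfolding prob_D by (rule binomial_poisson_limit[OF p])
        moreover have "pmf (map_pmf int (poisson_pmf (c * (t - s)))) z
            = (c * (t - s)) ^ k / fact k * exp (- (c * (t - s)))"
          unfolding k using st c by (subst pmf_map_inj') (auto simp: pmf_poisson)
        ultimately show ?thesis
          by simp
      next
        case False
        then have empty: "{\<omega> \<in> space N. D n s t \<omega> = z} = {}" for n
          by (auto simp: D_def)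
        have "pmf (map_pmf int (poisson_pmf (c * (t - s)))) z = 0"
          using False by (auto simp: pmf_eq_0_set_pmf)
        then show ?thesis
          unfolding empty by simp
      qed
      then have "\<P>(\<omega> in N. int (?N t \<omega>) - int (?N s \<omega>) = z) = pmf (map_pmf int (poisson_pmf (c * (t - s)))) z"
        by (rule LIMSEQ_unique[OF conv])
      then show "emeasure (distr N (count_space UNIV) (\<lambda>\<omega>. int (?N t \<omega>) - int (?N s \<omega>))) {z}
          = emeasure (measure_pmf (map_pmf int (poisson_pmf (c * (t - s))))) {z}"
        by (simp add: emeasure_distr[OF meas_diff] emeasure_eq_measure emeasure_pmf_single
            vimage_def Int_def conj_commute)
    qed auto
  qed
qed

section \<open>The scaling limit of the persistent random walk\<close>

theorem theorem2p1:
  fixes c0 c1 :: real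
    and M :: "real \<Rightarrow> 'a measure" and Y :: "real \<Rightarrow> nat \<Rightarrow> 'a \<Rightarrow> int"
    and N :: "'b measure" and e :: "nat \<Rightarrow> 'b \<Rightarrow> real"
  assumes "c0 > 0" and "c1 > 0"
    and "iid_exponential N e"
  shows
    "((\<forall>\<^sub>F dx in at_right 0. markov_chain (M dx) {-1, 1} (transition c0 c1 dx) (Y dx) \<and>
          (AE \<omega> in M dx. Y dx 0 \<omega> = -1)) \<longrightarrow>
        converges_in_distribution M (\<lambda>dx. interpolated_walk dx dx (Y dx))
          N (\<lambda>s \<omega>. - telegraph_process c0 c1 e s \<omega>) (at_right 0)) \<and>
     (c0 = c1 \<longrightarrow> poisson_process N c0 (counting_process c0 c0 e)) \<and>
     ((\<forall>\<^sub>F dx in at_right 0. markov_chain (M dx) {-1, 1} (transition c0 c1 dx) (Y dx) \<and>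
          (AE \<omega> in M dx. Y dx 0 \<omega> = 1)) \<longrightarrow>
        converges_in_distribution M (\<lambda>dx. interpolated_walk dx dx (Y dx))
          N (telegraph_process c1 c0 e) (at_right 0))"
proof (intro conjI impI)
  assume "\<forall>\<^sub>F dx in at_right 0. markov_chain (M dx) {-1, 1} (transition c0 c1 dx) (Y dx) \<and>
    (AE \<omega> in M dx. Y dx 0 \<omega> = -1)"
  then have "converges_in_distribution M (\<lambda>dx. interpolated_walk dx dx (Y dx))
      N (\<lambda>s \<omega>. real_of_int (-1) * telegraph_process c0 c1 e s \<omega>) (at_right 0)"
    by (intro converges_in_distribution_telegraph disjI1) (use assms in simp_all)
  then show "converges_in_distribution M (\<lambda>dx. interpolated_walk dx dx (Y dx))
      N (\<lambda>s \<omega>. - telegraph_process c0 c1 e s \<omega>) (at_right 0)"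
    by simp
next
  show "poisson_process N c0 (counting_process c0 c0 e)"
    by (rule poisson_process_counting[OF assms(3,1)])
next
  assume "\<forall>\<^sub>F dx in at_right 0. markov_chain (M dx) {-1, 1} (transition c0 c1 dx) (Y dx) \<and>
    (AE \<omega> in M dx. Y dx 0 \<omega> = 1)"
  then have "converges_in_distribution M (\<lambda>dx. interpolated_walk dx dx (Y dx))
      N (\<lambda>s \<omega>. real_of_int 1 * telegraph_process c1 c0 e s \<omega>) (at_right 0)"
    by (intro converges_in_distribution_telegraph disjI2) (use assms in simp_all)
  then show "converges_in_distribution M (\<lambda>dx. interpolated_walk dx dx (Y dx))
      N (telegraph_process c1 c0 e) (at_right 0)"
    by simp
qed

end
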